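(* Suppose $0<\beta\ll\alpha\ll 1$ and $n$ is sufficiently large; that is, there is $\alpha_0>0$ such that for every $0<\alpha\le\alpha_0$ there is $\beta_0>0$ such that for every $0<\beta\le\beta_0$ there is $n_0$ such that for all $n\ge n_0$ the following holds. Let $G$ be a $3$-connected graph on $n$ vertices with $\delta(G)\ge (2n+3)/5$. If there is a partition $V(G)=V_1\cup V_2$ with $|V_1|>(3/5-\alpha)n$, $d(V_1,V_2)\ge 1-3\alpha$, and $\deg(v_1,V_2)\ge (2n+3)/5-2\beta n$ for every $v_1\in V_1$, then $G$ contains a spanning generalized Halin graph.
   Context: All graphs are finite and simple. $\deg(v,S)$ is the number of neighbors of $v$ in $S$; $d(V_1,V_2)=e(V_1,V_2)/(|V_1||V_2|)$ where $e(V_1,V_2)$ is the number of edges with one end in $V_1$ and the other in $V_2$. For a tree $T$, $L(T)$ is its set of leaves; a HIST of $G$ is a spanning tree with no vertex of degree $2$; a spanning generalized Halin graph of $G$ is a spanning subgraph $T\cup C$ of $G$ with $T$ a HIST of $G$ and $C$ a cycle of $G$ with $V(C)=L(T)$. *)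

theory Defs
  imports Complex_Main "Graph_Theory.Digraph_Component"
begin

text \<open>
  A finite simple graph is a \<^locale>\<open>pair_graph\<close>: a finite, loop-free, symmetric relation
  on its vertex set, so an undirected edge \<open>uv\<close> is the pair of arcs \<open>(u, v)\<close> and \<open>(v, u)\<close>,
  and the degree of a vertex is its out-degree.
\<close>

definition degree :: "'a pair_pre_digraph \<Rightarrow> 'a \<Rightarrow> nat" where
  "degree G v = out_degree (with_proj G) v"

definition min_degree :: "'a pair_pre_digraph \<Rightarrow> nat" where
  "min_degree G = Min (degree G ` pverts G)"

definition degree_into :: "'a pair_pre_digraph \<Rightarrow> 'a \<Rightarrow> 'a set \<Rightarrow> nat" where
  "degree_into G v S = card {w \<in> S. (v, w) \<in> parcs G}"

text \<open>Undirected edges are counted, as two-element sets of end vertices.\<close>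

definition edges_between :: "'a pair_pre_digraph \<Rightarrow> 'a set \<Rightarrow> 'a set \<Rightarrow> nat" where
  "edges_between G A B = card {{u, v} | u v. u \<in> A \<and> v \<in> B \<and> (u, v) \<in> parcs G}"

definition density :: "'a pair_pre_digraph \<Rightarrow> 'a set \<Rightarrow> 'a set \<Rightarrow> real" where
  "density G A B = real (edges_between G A B) / (real (card A) * real (card B))"

definition k_connected :: "nat \<Rightarrow> 'a pair_pre_digraph \<Rightarrow> bool" where
  "k_connected k G \<longleftrightarrow> card (pverts G) > k \<and>
     (\<forall>X \<subseteq> pverts G. card X < k \<longrightarrow>
        Digraph_Component.connected (with_proj G \<restriction> (pverts G - X)))"

text \<open>
  The library's cycles are directed closed walks without repeated vertices, which in a symmetric
  digraph include the walks \<open>u, v, u\<close> along a single edge; the bound on the length excludes these.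
  For the same reason the library's \<^const>\<open>forest\<close> and \<^const>\<open>tree\<close> cannot be
  used for undirected graphs.
\<close>

definition undirected_cycle :: "'a pair_pre_digraph \<Rightarrow> ('a \<times> 'a) awalk \<Rightarrow> bool" where
  "undirected_cycle G p \<longleftrightarrow> pre_digraph.cycle (with_proj G) p \<and> length p \<ge> 3"

definition tree_graph :: "'a pair_pre_digraph \<Rightarrow> bool" where
  "tree_graph T \<longleftrightarrow> pair_graph T \<and> Digraph_Component.connected (with_proj T) \<and>
     (\<nexists>p. undirected_cycle T p)"

definition cycle_graph :: "'a pair_pre_digraph \<Rightarrow> bool" where
  "cycle_graph C \<longleftrightarrow> pair_graph C \<and>
     (\<exists>p. undirected_cycle C p \<and> pverts C = fst ` set p \<and> parcs C = set p \<union> (set p)\<inverse>)"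

definition leaves :: "'a pair_pre_digraph \<Rightarrow> 'a set" where
  "leaves T = {v \<in> pverts T. degree T v = 1}"

definition HIST :: "'a pair_pre_digraph \<Rightarrow> 'a pair_pre_digraph \<Rightarrow> bool" where
  "HIST T G \<longleftrightarrow> tree_graph T \<and> spanning (with_proj T) (with_proj G) \<and>
     (\<forall>v \<in> pverts T. degree T v \<noteq> 2)"

definition spanning_generalized_Halin ::
  "'a pair_pre_digraph \<Rightarrow> 'a pair_pre_digraph \<Rightarrow> bool" where
  "spanning_generalized_Halin H G \<longleftrightarrow> spanning (with_proj H) (with_proj G) \<and>
     (\<exists>T C. HIST T G \<and> cycle_graph C \<and> subgraph (with_proj C) (with_proj G) \<and>
        pverts C = leaves T \<and>
        with_proj H = Digraph_Component.union (with_proj T) (with_proj C))"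

end

theory Submission
  imports Defs
begin

text \<open>
  Moving the vertices of \<open>V\<^sub>2\<close> with few neighbours in \<open>V\<^sub>1\<close> to the large side, and then, if there
  are not too many of them, the vertices with many neighbours inside the large side to the small one, yields a
  partition \<open>A \<union> B\<close> that is almost complete bipartite, with \<open>card A\<close> about \<open>3n/5\<close> and \<open>card B\<close>
  about \<open>2n/5\<close>.

  The tree is rooted at a vertex \<open>w\<close> of \<open>B\<close> with the fewest non-neighbours in \<open>A\<close>. The root is joined
  to almost all of \<open>A\<close>, and every other vertex of \<open>B\<close> hangs off a set \<open>I\<close> of inner vertices in \<open>A\<close>,
  each with at least two children. Every non-neighbour \<open>v\<close> of \<open>w\<close> hangs, with one further vertex
  of \<open>A\<close>, off a vertex \<open>p v\<close> of \<open>B\<close> of its own. The cycle alternates between the remaining leaves on the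
  two sides, except that it uses \<open>m\<close> edges inside \<open>A\<close>; vertices of \<open>B\<close> with many
  non-neighbours get two private neighbours on the cycle. The closing of the cycle and the
  assignment of children are perfect matching problems in almost complete bipartite graphs.

  Counting leaves, with \<open>q\<close> non-neighbours of \<open>w\<close> and \<open>t = (2n + 3)/5 - card B\<close> this needs a matching of size
  \<open>m \<ge> 5t/2 + q\<close> in \<open>A\<close>. A vertex of \<open>A\<close> with \<open>k\<close> non-neighbours in \<open>B\<close> has at least \<open>t + k\<close> neighbours in \<open>A\<close>,
  so the degree sum inside \<open>A\<close> is at least \<open>t card A + q card B\<close>; as degrees inside \<open>A\<close> are small, a
  maximal matching is large enough. If many vertices of \<open>A\<close> have large degree
  inside \<open>A\<close>, the matching is found greedily.
\<close>

section \<open>Matchings and lists with separators\<close>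

text \<open>Greedy: at every index fewer than \<open>card J\<close> values have been taken, so
  \<open>F j\<close> still holds a fresh one.\<close>

lemma inj_choice:
  assumes "finite J" "\<And>j. j \<in> J \<Longrightarrow> finite (F j)" "\<And>j. j \<in> J \<Longrightarrow> card J \<le> card (F j)"
  shows "\<exists>c. inj_on c J \<and> (\<forall>j\<in>J. c j \<in> F j)"
proof -
  have "\<exists>c. inj_on c K \<and> (\<forall>j\<in>K. c j \<in> F j)" if "finite K" "K \<subseteq> J" for K
    using that
  proof (induction K)
    case (insert k K)
    then obtain c where c: "inj_on c K" "\<forall>j\<in>K. c j \<in> F j" by auto
    have "card (insert k K) \<le> card J"
      using insert.prems assms(1) card_mono by blast
    then have "card (c ` K) < card (F k)"
      using insert.hyps insert.prems assms(3)[of k] card_image_le[of K c] by simp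
    then obtain y where y: "y \<in> F k" "y \<notin> c ` K"
      using insert.hyps(1) by (meson card_mono finite_imageI leD subsetI)
    have "inj_on (c(k := y)) (insert k K)"
      using c(1) y(2) insert.hyps(2) by (auto simp: inj_on_def)
    moreover have "\<forall>j\<in>insert k K. (c(k := y)) j \<in> F j"
      using c(2) y(1) insert.hyps(2) by auto
    ultimately show ?case by blast
  qed auto
  from this[OF assms(1)] show ?thesis by blast
qed

lemma dense_bipartite_matching:
  fixes c d :: real
  assumes fin: "finite X" "finite Y" and XY: "card X \<le> card Y"
    and missX: "\<And>x. x \<in> X \<Longrightarrow> real (card {y \<in> Y. \<not> R x y}) \<le> c"
    and missY: "\<And>y. y \<in> Y \<Longrightarrow> real (card {x \<in> X. \<not> R x y}) \<le> d"
    and cd: "c + d \<le> card Y"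
  shows "\<exists>f. inj_on f X \<and> (\<forall>x\<in>X. f x \<in> Y \<and> R x (f x))"
proof -
  have step: "\<exists>f. inj_on f (insert x K) \<and> (\<forall>x\<in>insert x K. f x \<in> Y \<and> R x (f x))"
    if f: "inj_on f K" "\<forall>x\<in>K. f x \<in> Y \<and> R x (f x)" and K: "insert x K \<subseteq> X" "x \<notin> K"
    for f x K
  proof (cases "\<exists>y\<in>Y - f ` K. R x y")
    case True
    then obtain y where "y \<in> Y" "y \<notin> f ` K" "R x y" by auto
    then show ?thesis
      using f K(2) by (intro exI[of _ "f(x := y)"]) (auto simp: inj_on_def)
  next
    case False
    have finK: "finite K" by (rule finite_subset[OF _ fin(1)]) (use K(1) in auto)
    have "card (insert x K) \<le> card X" by (rule card_mono[OF fin(1) K(1)])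
    then have "card (f ` K) < card Y"
      using XY K(2) finK card_image_le[OF finK, of f] by simp
    then obtain y where y: "y \<in> Y" "y \<notin> f ` K"
      by (meson card_mono finK finite_imageI leD subsetI)
    have "\<exists>k\<in>K. R x (f k) \<and> R k y"
    proof (rule ccontr)
      assume no: "\<not> ?thesis"
      let ?K1 = "{k \<in> K. \<not> R x (f k)}" and ?K2 = "{k \<in> K. \<not> R k y}"
      have "card K \<le> card (?K1 \<union> ?K2)" using no finK by (intro card_mono) auto
      then have "card K \<le> card ?K1 + card ?K2"
        using card_Un_le[of ?K1 ?K2] by linarith
      moreover have "card ?K1 + card (Y - f ` K) \<le> card {y \<in> Y. \<not> R x y}"
      proof -
        have "card ?K1 = card (f ` ?K1)"
          using f(1) by (metis (no_types, lifting) card_image inj_on_subset mem_Collect_eq subsetI)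
        then have "card ?K1 + card (Y - f ` K) = card (f ` ?K1 \<union> (Y - f ` K))"
          using finK fin(2) by (subst card_Un_disjoint) auto
        also have "\<dots> \<le> card {y \<in> Y. \<not> R x y}"
          using fin(2) f(2) False by (intro card_mono) auto
        finally show ?thesis .
      qed
      moreover have "card ?K2 + 1 \<le> card {x \<in> X. \<not> R x y}"
      proof -
        have "\<not> R x y" using False y by auto
        then have "insert x ?K2 \<subseteq> {x \<in> X. \<not> R x y}" using K(1) by auto
        then have "card (insert x ?K2) \<le> card {x \<in> X. \<not> R x y}"
          using fin(1) by (intro card_mono) auto
        then show ?thesis using K(2) finK by simp
      qed
      moreover have "card (Y - f ` K) = card Y - card K" "card K \<le> card Y"
      proof -
        have "f ` K \<subseteq> Y" using f(2) by auto
        moreover have "card (f ` K) = card K" using f(1) by (rule card_image)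
        ultimately show "card (Y - f ` K) = card Y - card K" "card K \<le> card Y"
          using fin(2) by (metis card_Diff_subset finK finite_imageI, metis card_mono)
      qed
      ultimately have "card {y \<in> Y. \<not> R x y} + card {x \<in> X. \<not> R x y} \<ge> Suc (card Y)"
        by simp
      moreover have "x \<in> X" using K(1) by simp
      ultimately show False using missX[of x] missY[of y] y(1) cd by linarith
    qed
    then obtain k where k: "k \<in> K" "R x (f k)" "R k y" by auto
    show ?thesis
      using f K(2) k y by (intro exI[of _ "f(k := y, x := f k)"]) (auto simp: inj_on_def)
  qed
  have "\<exists>f. inj_on f K \<and> (\<forall>x\<in>K. f x \<in> Y \<and> R x (f x))" if "finite K" "K \<subseteq> X" for K
    using that
  proof (induction K)
    case (insert x K)
    then show ?case using step[of _ K x] by auto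
  qed auto
  from this[OF fin(1)] show ?thesis by blast
qed

text \<open>Each chosen edge blocks two vertices, so before the last of \<open>m\<close> choices
  fewer than \<open>2 * m\<close> are blocked. The matching is a list of pairs with distinct
  flattening, so that its edges can serve directly as blocks of the cycle.\<close>

lemma greedy_matching:
  assumes "\<And>S. S \<subseteq> A \<Longrightarrow> finite S \<Longrightarrow> card S < 2 * m \<Longrightarrow> \<exists>x\<in>A - S. \<exists>y\<in>A - S. x \<noteq> y \<and> R x y"
  shows "\<exists>ps. length ps = m \<and> distinct (concat (map (\<lambda>(x, y). [x, y]) ps)) \<and>
    (\<forall>(x, y)\<in>set ps. x \<in> A \<and> y \<in> A \<and> R x y)"
  using assms
proof (induction m)
  case (Suc m)
  have "\<exists>x\<in>A - S. \<exists>y\<in>A - S. x \<noteq> y \<and> R x y" if "S \<subseteq> A" "finite S" "card S < 2 * m" for S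
    using Suc.prems[of S] that by simp
  from Suc.IH[OF this] obtain ps where ps: "length ps = m" "distinct (concat (map (\<lambda>(x, y). [x, y]) ps))"
    "\<forall>(x, y)\<in>set ps. x \<in> A \<and> y \<in> A \<and> R x y" by auto
  let ?l = "concat (map (\<lambda>(x, y). [x, y]) ps)"
  have "length ?l = 2 * m"
    unfolding ps(1)[symmetric] by (induction ps) auto
  then have "card (set ?l) < 2 * Suc m" by (intro le_less_trans[OF card_length]) simp
  moreover have "set ?l \<subseteq> A" using ps(3) by auto
  ultimately have "\<exists>x\<in>A - set ?l. \<exists>y\<in>A - set ?l. x \<noteq> y \<and> R x y"
    by (intro Suc.prems) auto
  then obtain x y where "x \<in> A - set ?l" "y \<in> A - set ?l" "x \<noteq> y" "R x y" by blast
  then show ?case using ps by (intro exI[of _ "(x, y) # ps"]) auto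
qed auto

section \<open>Lists of blocks with separators\<close>

lemma distinct_concat_insert_separators:
  assumes "length bs = length cs" "distinct (concat bs)" "distinct cs"
    "set (concat bs) \<inter> set cs = {}"
  shows "distinct (concat (map2 (\<lambda>b c. b @ [c]) bs cs))"
    "set (concat (map2 (\<lambda>b c. b @ [c]) bs cs)) = set (concat bs) \<union> set cs"
proof -
  have *: "set (concat (map2 (\<lambda>b c. b @ [c]) bs cs)) = set (concat bs) \<union> set cs"
    if "length bs = length cs" for bs :: "'a list list" and cs
    using that by (induction bs cs rule: list_induct2) auto
  then show "set (concat (map2 (\<lambda>b c. b @ [c]) bs cs)) = set (concat bs) \<union> set cs"
    using assms(1) .
  show "distinct (concat (map2 (\<lambda>b c. b @ [c]) bs cs))"
    using assms
  proof (induction bs cs rule: list_induct2)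
    case (Cons b bs c cs)
    then show ?case using *[OF Cons.hyps] by (auto simp del: set_concat)
  qed simp
qed

text \<open>Nothing is asked of the successor of the last separator: that one closes the cycle and
  is treated separately.\<close>

lemma successively_insert_separators:
  assumes "length bs = length cs"
    "\<And>b. b \<in> set bs \<Longrightarrow> b \<noteq> [] \<and> successively R b"
    "\<And>i. i < length bs \<Longrightarrow> R (last (bs ! i)) (cs ! i)"
    "\<And>i. Suc i < length bs \<Longrightarrow> R (cs ! i) (hd (bs ! Suc i))"
  shows "successively R (concat (map2 (\<lambda>b c. b @ [c]) bs cs))"
  using assms
proof (induction bs cs rule: list_induct2)
  case (Cons b bs c cs)
  have IH: "successively R (concat (map2 (\<lambda>b c. b @ [c]) bs cs))"
    using Cons.IH Cons.prems(1) Cons.prems(2)[of "Suc _"] Cons.prems(3)[of "Suc _"] by fastforce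
  have "R c (hd (concat (map2 (\<lambda>b c. b @ [c]) bs cs)))" if "bs \<noteq> []"
  proof -
    obtain b' bs' c' cs' where [simp]: "bs = b' # bs'" "cs = c' # cs'"
      using \<open>bs \<noteq> []\<close> Cons.hyps by (metis length_Suc_conv list.exhaust)
    show ?thesis using Cons.prems(3)[of 0] Cons.prems(1)[of b'] by simp
  qed
  moreover have "b \<noteq> []" "successively R b" using Cons.prems(1)[of b] by auto
  moreover have "R (last b) c" using Cons.prems(2)[of 0] by simp
  ultimately show ?case
    using IH Cons.hyps by (cases "bs = []") (auto simp: successively_append_iff successively_Cons)
qed simp

section \<open>Graphs from lists and from parent functions\<close>

definition cycle_of_list :: "'a list \<Rightarrow> 'a pair_pre_digraph" where
  "cycle_of_list vs = \<lparr>pverts = set vs,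
     parcs = set (zip vs (rotate1 vs)) \<union> (set (zip vs (rotate1 vs)))\<inverse>\<rparr>"

text \<open>For \<open>v = u\<close> this arc list is \<open>zip vs (rotate1 vs)\<close> with
  \<open>vs = u # us\<close>, which pairs each vertex with its cyclic successor and is thus a closed
  walk.\<close>

lemma pcas_zip: "pcas u (zip (u # us) (us @ [v])) v"
  by (induction us arbitrary: u) auto

lemma pawalk_verts_zip: "pawalk_verts u (zip (u # us) (us @ [v])) = u # us @ [v]"
  by (induction us arbitrary: u) auto

lemma set_zip_successively:
  "successively R (u # us @ [v]) \<Longrightarrow> (x, y) \<in> set (zip (u # us) (us @ [v])) \<Longrightarrow> R x y"
  by (induction us arbitrary: u) auto

lemma fst_set_zip: "length xs = length ys \<Longrightarrow> fst ` set (zip xs ys) = set xs"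
  by (metis list.set_map map_fst_zip)

lemma cycle_graph_cycle_of_list:
  assumes "distinct vs" "length vs \<ge> 3"
  shows "cycle_graph (cycle_of_list vs)"
proof -
  obtain u us where vs: "vs = u # us" using assms(2) by (cases vs) auto
  then have us: "us \<noteq> []" using assms(2) by auto
  let ?p = "zip vs (rotate1 vs)" and ?C = "cycle_of_list vs"
  have p: "?p = zip (u # us) (us @ [u])" by (simp add: vs)
  have arcs: "parcs ?C = set ?p \<union> (set ?p)\<inverse>" and verts: "pverts ?C = set vs"
    by (simp_all add: cycle_of_list_def)
  have sub: "set ?p \<subseteq> set vs \<times> set vs"
    by (auto dest: set_zip_leftD set_zip_rightD)
  \<comment> \<open>Loop-freeness: neighbours in a distinct list differ, and the wrap-around pair
    differs because there is more than one vertex.\<close>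
  have "successively (\<noteq>) (u # us @ [u])"
  proof -
    have "successively (\<noteq>) vs" using assms(1) by (auto simp: successively_conv_nth nth_eq_iff_index_eq)
    moreover have "last vs \<noteq> u" using vs us assms(1) by auto
    ultimately show ?thesis
      using vs us successively_append_iff[of "(\<noteq>)" vs "[u]"] by auto
  qed
  from set_zip_successively[OF this] have irr: "x \<noteq> y" if "(x, y) \<in> set ?p" for x y
    using that p by metis
  have "pair_graph ?C"
  proof
    show "fst e \<in> pverts ?C" "snd e \<in> pverts ?C" if "e \<in> parcs ?C" for e
      using that sub by (auto simp: arcs verts)
    show "finite (pverts ?C)" "finite (parcs ?C)" by (simp_all add: arcs verts)
    show "fst e \<noteq> snd e" if "e \<in> parcs ?C" for e
      using that irr[of "fst e" "snd e"] irr[of "snd e" "fst e"] by (cases e) (auto simp: arcs)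
    show "symmetric (with_proj ?C)"
      by (auto simp: symmetric_def arcs sym_def)
  qed
  moreover have "undirected_cycle ?C ?p"
    unfolding undirected_cycle_def pre_digraph.cycle_def pre_digraph.awalk_def
      awalk_verts_with_proj_eq cas_with_proj_eq
  proof (intro conjI exI)
    show "u \<in> verts (with_proj ?C)" unfolding with_proj_simps verts by (simp add: vs)
    show "set ?p \<subseteq> arcs (with_proj ?C)" by (simp add: arcs)
    show "pcas u ?p u" unfolding p by (rule pcas_zip)
    show "distinct (tl (pawalk_verts u ?p))"
      unfolding p pawalk_verts_zip using assms(1) vs by auto
    show "?p \<noteq> []" by (simp add: vs)
    show "length ?p \<ge> 3" using assms(2) by simp
  qed
  ultimately show ?thesis
    unfolding cycle_graph_def by (intro conjI exI[of _ ?p]) (simp_all add: arcs verts fst_set_zip)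
qed

lemma parcs_cycle_of_list:
  assumes "successively R vs" "R (last vs) (hd vs)" "symp R" "vs \<noteq> []"
    and "(x, y) \<in> parcs (cycle_of_list vs)"
  shows "R x y"
proof -
  obtain u us where vs: "vs = u # us" using assms(4) by (cases vs) auto
  have "successively R (u # us @ [u])"
    using assms(1,2) vs successively_append_iff[of R vs "[u]"] by auto
  from set_zip_successively[OF this] show ?thesis
    using assms(3,5) vs by (auto simp: cycle_of_list_def dest: sympD)
qed

section \<open>Trees from parent functions\<close>

definition parent_tree :: "'a set \<Rightarrow> 'a \<Rightarrow> ('a \<Rightarrow> 'a) \<Rightarrow> 'a pair_pre_digraph" where
  "parent_tree V w par = \<lparr>pverts = V,
     parcs = (\<lambda>v. (v, par v)) ` (V - {w}) \<union> (\<lambda>v. (par v, v)) ` (V - {w})\<rparr>"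

lemma pcas_snd_fst:
  "pcas u p v \<Longrightarrow> Suc i < length p \<Longrightarrow> fst (p ! Suc i) = snd (p ! i)"
proof (induction p arbitrary: u i)
  case (Cons e p)
  then show ?case by (cases i; cases p) auto
qed simp

lemma pcas_ends:
  "pcas u p v \<Longrightarrow> p \<noteq> [] \<Longrightarrow> fst (p ! 0) = u \<and> snd (p ! (length p - 1)) = v"
proof (induction p arbitrary: u)
  case (Cons e p)
  then show ?case by (cases p) auto
qed simp

lemma tl_pawalk_verts: "tl (pawalk_verts u p) = map snd p" if "pcas u p v"
proof -
  have "pawalk_verts u p = u # map snd p" using that
    by (induction p arbitrary: u) auto
  then show ?thesis by simp
qed

text \<open>The strictly falling rank rules out cycles of \<open>par\<close> and makes iterated
  parents end in \<open>w\<close>.\<close>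

locale rooted_parent =
  fixes V :: "'a set" and w :: 'a and par :: "'a \<Rightarrow> 'a" and rk :: "'a \<Rightarrow> nat"
  assumes finV: "finite V" and wV: "w \<in> V"
    and parV: "v \<in> V \<Longrightarrow> v \<noteq> w \<Longrightarrow> par v \<in> V"
    and rk: "v \<in> V \<Longrightarrow> v \<noteq> w \<Longrightarrow> rk (par v) < rk v"
begin

abbreviation "T \<equiv> parent_tree V w par"

lemma verts_T: "pverts T = V" by (simp add: parent_tree_def)

lemma arc_T_iff:
  "(x, y) \<in> parcs T \<longleftrightarrow> (x \<in> V \<and> x \<noteq> w \<and> y = par x) \<or> (y \<in> V \<and> y \<noteq> w \<and> x = par y)"
  by (auto simp: parent_tree_def)

lemma pair_graph_T: "pair_graph T"
proof
  show "fst e \<in> pverts T" "snd e \<in> pverts T" if "e \<in> parcs T" for e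
    using that by (auto simp: parent_tree_def dest: parV)
  show "finite (pverts T)" "finite (parcs T)" by (auto simp: parent_tree_def finV)
  show "fst e \<noteq> snd e" if "e \<in> parcs T" for e
    using that by (auto simp: parent_tree_def dest!: rk)
  show "symmetric (with_proj T)"
    by (auto simp: symmetric_def sym_def arc_T_iff)
qed

sublocale T: pair_graph T by (rule pair_graph_T)

lemma reach_root: "v \<in> V \<Longrightarrow> v \<rightarrow>\<^sup>*\<^bsub>with_proj T\<^esub> w"
proof (induction "rk v" arbitrary: v rule: less_induct)
  case less
  show ?case
  proof (cases "v = w")
    case True
    then show ?thesis using wV T.reachable_refl[of w] by (simp add: verts_T)
  next
    case False
    then have "par v \<rightarrow>\<^sup>*\<^bsub>with_proj T\<^esub> w" using less rk parV by blast
    moreover have "(v, par v) \<in> parcs T" using False less.prems by (simp add: arc_T_iff)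
    ultimately show ?thesis using T.adj_reachable_trans by simp
  qed
qed

lemma connected_T: "Digraph_Component.connected (with_proj T)"
proof -
  have "mk_symmetric (with_proj T) = T"
    by (auto simp: mk_symmetric_def parent_tree_def)
  moreover have "u \<rightarrow>\<^sup>*\<^bsub>with_proj T\<^esub> v" if "u \<in> V" "v \<in> V" for u v
    using reach_root[OF that(1)] symmetric_reachable[OF T.pair_sym_arcs reach_root[OF that(2)]]
    by (rule T.reachable_trans)
  ultimately show ?thesis
    using wV by (auto simp: connected_def strongly_connected_def verts_T)
qed

text \<open>Both neighbours on a cycle of a vertex of maximal rank would have to be its parent.\<close>

lemma acyclic_T: "\<not> undirected_cycle T p"
proof
  assume "undirected_cycle T p"
  then obtain u where u: "set p \<subseteq> parcs T" "pcas u p u" "distinct (map snd p)" "length p \<ge> 3"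
    using tl_pawalk_verts
    by (fastforce simp: undirected_cycle_def pre_digraph.cycle_def pre_digraph.awalk_def
      awalk_verts_with_proj_eq cas_with_proj_eq)
  let ?k = "length p"
  have "p \<noteq> []" using u(4) by auto
  \<comment> \<open>The cyclic successor of a position, so that the closing of the walk needs no
    separate treatment below.\<close>
  define nxt where "nxt i = (if Suc i = ?k then 0 else Suc i)" for i
  have nxt: "nxt i < ?k" "fst (p ! nxt i) = snd (p ! i)" if "i < ?k" for i
  proof -
    show "nxt i < ?k" using that by (auto simp: nxt_def)
    show "fst (p ! nxt i) = snd (p ! i)"
    proof (cases "Suc i = ?k")
      case True
      then have "?k - 1 = i" by simp
      then show ?thesis using True pcas_ends[OF u(2) \<open>p \<noteq> []\<close>] by (simp add: nxt_def)
    next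
      case False
      then show ?thesis using that pcas_snd_fst[OF u(2), of i] by (simp add: nxt_def)
    qed
  qed
  let ?S = "(\<lambda>j. rk (snd (p ! j))) ` {..<?k}"
  have S: "finite ?S" "?S \<noteq> {}" using \<open>p \<noteq> []\<close> by (simp_all add: lessThan_empty_iff)
  obtain i where i: "i < ?k" "Max ?S = rk (snd (p ! i))" using Max_in[OF S] by auto
  have max: "rk (snd (p ! j)) \<le> rk (snd (p ! i))" if "j < ?k" for j
    using Max_ge[OF S(1)] that unfolding i(2)[symmetric] by blast
  define j where "j = (if i = 0 then ?k - 1 else i - 1)"
  have j: "j < ?k" "nxt j = i" using i(1) u(4) by (auto simp: j_def nxt_def)
  have arc: "(fst (p ! l), snd (p ! l)) \<in> parcs T" if "l < ?k" for l
    using u(1) that nth_mem by auto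
  have up: "y = par x" if "(x, y) \<in> parcs T \<or> (y, x) \<in> parcs T" "rk y \<le> rk x" for x y
    using that rk[of y] by (auto simp: arc_T_iff)
  have "(snd (p ! j), snd (p ! i)) \<in> parcs T"
    by (metis arc[OF i(1)] nxt(2)[OF j(1)] j(2))
  then have "snd (p ! j) = par (snd (p ! i))" using up max[OF j(1)] by blast
  moreover have "(snd (p ! i), snd (p ! nxt i)) \<in> parcs T"
    by (metis arc[OF nxt(1)[OF i(1)]] nxt(2)[OF i(1)])
  then have "snd (p ! nxt i) = par (snd (p ! i))" using up max[OF nxt(1)[OF i(1)]] by blast
  ultimately have "map snd p ! j = map snd p ! nxt i" using j(1) nxt(1)[OF i(1)] by simp
  then have "j = nxt i"
    using u(3) j(1) nxt(1)[OF i(1)] by (simp add: nth_eq_iff_index_eq del: nth_map)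
  \<comment> \<open>Predecessor and successor of a position coincide only when the length divides
    two, but the length is at least three.\<close>
  then show False using i(1) u(4) by (auto simp: j_def nxt_def split: if_splits)
qed

lemma degree_T:
  assumes "v \<in> V"
  shows "degree T v = card {u \<in> V - {w}. par u = v} + (if v = w then 0 else 1)"
proof -
  let ?K = "{u \<in> V - {w}. par u = v}" and ?P = "if v = w then {} else {par v}"
  have "out_arcs (with_proj T) v = Pair v ` (?K \<union> ?P)"
  proof -
    have "out_arcs (with_proj T) v = {e. fst e = v \<and> (v, snd e) \<in> parcs T}"
      by (auto simp: out_arcs_def)
    also have "\<dots> = Pair v ` (?K \<union> ?P)"
      unfolding arc_T_iff using assms parV by (auto simp: image_iff)
    finally show ?thesis .
  qed
  then have "degree T v = card (?K \<union> ?P)"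
    by (simp add: degree_def out_degree_def card_image inj_on_def)
  \<comment> \<open>A child that is also the parent would have rank both above and below that of
    \<open>v\<close>.\<close>
  also have "\<dots> = card ?K + card ?P"
    using finV assms by (intro card_Un_disjoint) (auto, metis less_asym rk)
  finally show ?thesis by simp
qed

lemma tree_graph_T: "tree_graph T"
  using pair_graph_T connected_T acyclic_T by (auto simp: tree_graph_def)

end

text \<open>A non-root vertex has one neighbour more than it has children, so degree two means
  exactly one child and a leaf is a childless vertex. Three children keep the root from being a leaf
  or having degree two.\<close>

lemma generalized_Halin_from_parents:
  assumes G: "pair_graph G"
    and par: "rooted_parent (pverts G) w par rk"
    and arc: "\<And>v. v \<in> pverts G \<Longrightarrow> v \<noteq> w \<Longrightarrow> (v, par v) \<in> parcs G"
    and root: "card {u \<in> pverts G - {w}. par u = w} \<ge> 3"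
    and inner: "\<And>v. v \<in> pverts G \<Longrightarrow> v \<noteq> w \<Longrightarrow> card {u \<in> pverts G - {w}. par u = v} \<noteq> 1"
    and vs: "distinct vs" "length vs \<ge> 3"
      "set vs = {v \<in> pverts G - {w}. {u \<in> pverts G - {w}. par u = v} = {}}"
      "successively (\<lambda>x y. (x, y) \<in> parcs G) vs" "(last vs, hd vs) \<in> parcs G"
  shows "\<exists>H. spanning_generalized_Halin H G"
proof -
  interpret G: pair_graph G by (rule G)
  interpret rooted_parent "pverts G" w par rk by (rule par)
  let ?C = "cycle_of_list vs"
  have C: "cycle_graph ?C" using cycle_graph_cycle_of_list[OF vs(1,2)] .
  then have wfC: "wf_digraph (with_proj ?C)"
    by (simp add: cycle_graph_def wf_digraph_wp_iff pair_graph_def pair_digraph_def pair_fin_digraph_def)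
  have arcsC: "parcs ?C \<subseteq> parcs G"
  proof (rule subrelI)
    have "symp (\<lambda>x y. (x, y) \<in> parcs G)" using G.arcs_symmetric by (auto simp: symp_def)
    moreover have "vs \<noteq> []" using vs(2) by auto
    ultimately show "(x, y) \<in> parcs G" if "(x, y) \<in> parcs ?C" for x y
      using parcs_cycle_of_list[OF vs(4,5) _ _ that] by simp
  qed
  have arcsT: "parcs T \<subseteq> parcs G"
    using arc G.arcs_symmetric by (auto simp: arc_T_iff)
  have deg: "degree T v \<noteq> 2" if "v \<in> pverts G" for v
    using degree_T[OF that] root inner[OF that] by (cases "v = w") auto
  have spT: "spanning (with_proj T) (with_proj G)"
    using arcsT G.wf_digraph T.wf_digraph
    by (auto simp: spanning_def subgraph_def verts_T)
  then have "HIST T G"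
    using tree_graph_T deg by (auto simp: HIST_def verts_T)
  moreover have subC: "subgraph (with_proj ?C) (with_proj G)"
    using arcsC G.wf_digraph wfC vs(3) by (auto simp: subgraph_def cycle_of_list_def)
  moreover have "pverts ?C = leaves T"
  proof -
    have "degree T v = 1 \<longleftrightarrow> v \<noteq> w \<and> {u \<in> pverts G - {w}. par u = v} = {}" if "v \<in> pverts G" for v
      using degree_T[OF that] root finV by (cases "v = w") (auto simp: card_eq_0_iff)
    then show ?thesis using vs(3) by (auto simp: leaves_def verts_T cycle_of_list_def)
  qed
  moreover define H where "H = \<lparr>pverts = pverts T \<union> pverts ?C, parcs = parcs T \<union> parcs ?C\<rparr>"
  moreover have "with_proj H = Digraph_Component.union (with_proj T) (with_proj ?C)"
    by (simp add: H_def with_proj_def union_def)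
  moreover have "spanning (with_proj H) (with_proj G)"
  proof -
    have "pverts H = pverts G" using vs(3) by (auto simp: H_def verts_T cycle_of_list_def)
    moreover have "parcs H \<subseteq> parcs G" using arcsT arcsC by (auto simp: H_def)
    moreover from calculation have "wf_digraph (with_proj H)"
      by (auto dest: G.in_arcsD1 G.in_arcsD2
        simp: wf_digraph_wp_iff pair_wf_digraph_def)
    ultimately show ?thesis using G.wf_digraph by (auto simp: spanning_def subgraph_def)
  qed
  ultimately show ?thesis using C unfolding spanning_generalized_Halin_def by blast
qed

section \<open>Assembling tree and cycle\<close>

text \<open>Distinctness of the concatenation makes the blocks disjoint, and distinct as none is
  empty, so no two of them can share the chosen element.\<close>

lemma inj_on_choose_block_element:
  assumes "distinct (concat bs)" "\<And>b. b \<in> set bs \<Longrightarrow> h b \<in> set b"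
  shows "inj_on (\<lambda>i. h (bs ! i)) {..<length bs}"
proof -
  have "[] \<notin> set bs" using assms(2) by force
  then have "distinct bs" using assms(1) by (simp add: distinct_concat_iff removeAll_id)
  have "i = j" if ij: "i < length bs" "j < length bs" "h (bs ! i) = h (bs ! j)" for i j
  proof -
    have "h (bs ! i) \<in> set (bs ! i) \<inter> set (bs ! j)"
      using assms(2)[of "bs ! i"] assms(2)[of "bs ! j"] ij by simp
    then have "bs ! i = bs ! j"
      using assms(1) ij(1,2) unfolding distinct_concat_iff by (metis empty_iff nth_mem)
    then show ?thesis using \<open>distinct bs\<close> ij(1,2) by (simp add: nth_eq_iff_index_eq)
  qed
  then show ?thesis by (auto simp: inj_on_def)
qed

text \<open>The blocks are arranged cyclically and each gap is filled by a vertex of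
  \<open>C\<close>, which is a matching of gaps with \<open>C\<close>. A gap excludes the
  non-neighbours of its two ends. A vertex of \<open>A\<close> ends at most one block and starts at
  most one, so each non-neighbour of \<open>y\<close> excludes at most two gaps. This doubles both
  bounds.\<close>

lemma cycle_through_blocks:
  fixes c d :: real
  assumes sym: "symp E" and fin: "finite A" "finite C"
    and bs: "distinct (concat bs)" "set (concat bs) \<inter> C = {}" "length bs = card C" "bs \<noteq> []"
    and blocks: "\<And>b. b \<in> set bs \<Longrightarrow> b \<noteq> [] \<and> successively E b \<and> hd b \<in> A \<and> last b \<in> A"
    and missA: "\<And>v. v \<in> A \<Longrightarrow> real (card {y \<in> C. \<not> E v y}) \<le> c"
    and missC: "\<And>y. y \<in> C \<Longrightarrow> real (card {v \<in> A. \<not> E v y}) \<le> d"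
    and cd: "2 * c + 2 * d \<le> card C"
  shows "\<exists>vs. distinct vs \<and> set vs = set (concat bs) \<union> C \<and> successively E vs \<and> E (last vs) (hd vs)"
proof -
  define r where "r = length bs"
  have r: "r > 0" "r = card C" using bs(3,4) by (simp_all add: r_def flip: bs(3))
  define nx where "nx i = Suc i mod r" for i
  have nx: "nx i < r" if "i < r" for i using r that by (simp add: nx_def)
  have nx_inj: "inj_on nx {..<r}"
    by (rule inj_onI) (auto simp: nx_def mod_Suc split: if_splits)
  have inA: "hd (bs ! i) \<in> A" "last (bs ! i) \<in> A" if "i < r" for i
    using blocks that by (auto simp: r_def)
  have inj_last: "inj_on (\<lambda>i. last (bs ! i)) {..<r}"
    unfolding r_def by (rule inj_on_choose_block_element[OF bs(1)]) (use blocks in auto)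
  have "inj_on (\<lambda>i. hd (bs ! i)) {..<r}"
    unfolding r_def by (rule inj_on_choose_block_element[OF bs(1)]) (use blocks in auto)
  then have inj_hd: "inj_on (\<lambda>i. hd (bs ! nx i)) {..<r}"
    using comp_inj_on[OF nx_inj, of "\<lambda>i. hd (bs ! i)"] nx
    by (auto simp: o_def intro: inj_on_subset)
  let ?R = "\<lambda>i y. E (last (bs ! i)) y \<and> E y (hd (bs ! nx i))"
  have bound: "card {i \<in> {..<r}. \<not> E (h i) y} \<le> card {v \<in> A. \<not> E v y}"
    if "inj_on h {..<r}" "h ` {..<r} \<subseteq> A" for h y
  proof -
    have "card {i \<in> {..<r}. \<not> E (h i) y} = card (h ` {i \<in> {..<r}. \<not> E (h i) y})"
      by (intro card_image[symmetric] inj_on_subset[OF that(1)]) auto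
    also have "\<dots> \<le> card {v \<in> A. \<not> E v y}"
      using fin(1) that(2) by (intro card_mono) auto
    finally show ?thesis .
  qed
  have "\<exists>f. inj_on f {..<r} \<and> (\<forall>i\<in>{..<r}. f i \<in> C \<and> ?R i (f i))"
  proof (rule dense_bipartite_matching[where c = "2 * c" and d = "2 * d"])
    show "finite {..<r}" "finite C" "card {..<r} \<le> card C" using fin(2) r by auto
    show "2 * c + 2 * d \<le> card C" by (rule cd)
    show "real (card {y \<in> C. \<not> ?R i y}) \<le> 2 * c" if "i \<in> {..<r}" for i
    proof -
      have "{y \<in> C. \<not> ?R i y} = {y \<in> C. \<not> E (last (bs ! i)) y} \<union> {y \<in> C. \<not> E (hd (bs ! nx i)) y}"
        using sym by (auto dest: sympD)
      then have "card {y \<in> C. \<not> ?R i y} \<le>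
          card {y \<in> C. \<not> E (last (bs ! i)) y} + card {y \<in> C. \<not> E (hd (bs ! nx i)) y}"
        by (simp add: card_Un_le)
      moreover have "last (bs ! i) \<in> A" "hd (bs ! nx i) \<in> A" using that inA nx by auto
      ultimately show ?thesis using missA[of "last (bs ! i)"] missA[of "hd (bs ! nx i)"] by linarith
    qed
    show "real (card {i \<in> {..<r}. \<not> ?R i y}) \<le> 2 * d" if "y \<in> C" for y
    proof -
      have "{i \<in> {..<r}. \<not> ?R i y} = {i \<in> {..<r}. \<not> E (last (bs ! i)) y} \<union> {i \<in> {..<r}. \<not> E (hd (bs ! nx i)) y}"
        using sym by (auto dest: sympD)
      then have "card {i \<in> {..<r}. \<not> ?R i y} \<le>
          card {i \<in> {..<r}. \<not> E (last (bs ! i)) y} + card {i \<in> {..<r}. \<not> E (hd (bs ! nx i)) y}"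
        by (simp add: card_Un_le)
      moreover have "card {i \<in> {..<r}. \<not> E (last (bs ! i)) y} \<le> card {v \<in> A. \<not> E v y}"
        using inj_last inA by (intro bound) auto
      moreover have "card {i \<in> {..<r}. \<not> E (hd (bs ! nx i)) y} \<le> card {v \<in> A. \<not> E v y}"
        using inj_hd inA nx by (intro bound) auto
      ultimately show ?thesis using missC[OF that] by linarith
    qed
  qed
  then obtain f where f: "inj_on f {..<r}" "\<And>i. i < r \<Longrightarrow> f i \<in> C \<and> ?R i (f i)" by auto
  define cs where "cs = map f [0..<r]"
  have cs: "length cs = r" "distinct cs" "\<And>i. i < r \<Longrightarrow> cs ! i = f i"
    using f(1) by (auto simp: cs_def distinct_map lessThan_atLeast0)
  \<comment> \<open>There are as many gaps as vertices of \<open>C\<close>, so the matching uses up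
    \<open>C\<close>.\<close>
  have "f ` {..<r} = C"
    using f r fin(2) by (intro card_subset_eq) (auto simp: card_image)
  then have cs_set: "set cs = C" by (auto simp: cs_def lessThan_atLeast0)
  define vs where "vs = concat (map2 (\<lambda>b c. b @ [c]) bs cs)"
  have len: "length bs = length cs" using cs(1) by (simp add: r_def)
  have "distinct vs" "set vs = set (concat bs) \<union> C"
    using distinct_concat_insert_separators[OF len bs(1) cs(2)] bs(2) cs_set
    unfolding vs_def by auto
  moreover have "successively E vs"
    unfolding vs_def
  proof (rule successively_insert_separators[OF len])
    show "b \<noteq> [] \<and> successively E b" if "b \<in> set bs" for b using blocks[OF that] by blast
    show "E (last (bs ! i)) (cs ! i)" if "i < length bs" for i
      using f(2)[of i] cs(3)[of i] that by (simp add: r_def)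
    show "E (cs ! i) (hd (bs ! Suc i))" if "Suc i < length bs" for i
      using f(2)[of i] cs(3)[of i] that by (simp add: r_def nx_def)
  qed
  moreover have "E (last vs) (hd vs)"
  proof -
    obtain b bs' where b: "bs = b # bs'" using bs(4) by (cases bs) auto
    obtain c cs' where c: "cs = c # cs'" using len bs(4) by (cases cs) auto
    have "hd vs = hd (bs ! 0)" using blocks[of b] by (simp add: vs_def b c)
    moreover have "last vs = last cs"
    proof -
      have "last (concat (map2 (\<lambda>b c. b @ [c]) bs cs)) = last cs"
        if "length bs = length cs" "bs \<noteq> []" for bs :: "'a list list" and cs
        using that
      proof (induction bs cs rule: list_induct2)
        case (Cons b bs c cs)
        then show ?case by (cases bs; cases cs) auto
      qed simp
      then show ?thesis using len bs(4) by (simp add: vs_def)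
    qed
    moreover have "last cs = cs ! (r - 1)" using cs(1) r(1) last_conv_nth[of cs] by auto
    moreover have "nx (r - 1) = 0" using r(1) by (simp add: nx_def)
    ultimately show ?thesis using f(2)[of "r - 1"] cs(3)[of "r - 1"] r(1) by simp
  qed
  ultimately show ?thesis by blast
qed

text \<open>
  Vertices in \<open>U\<close> may have few neighbours in \<open>I\<close>, so their parents are prescribed by \<open>z\<close>.
\<close>

lemma two_children_assignment:
  fixes c d :: real
  assumes sym: "symp E" and fin: "finite I" "finite C" "finite U" and UC: "U \<inter> C = {}"
    and z: "inj_on z U" "\<And>u. u \<in> U \<Longrightarrow> z u \<in> I \<and> E u (z u)"
    and size: "2 * card I \<le> card C + card U"
    and missI: "\<And>v. v \<in> I \<Longrightarrow> real (card {y \<in> C. \<not> E v y}) \<le> c"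
    and missC: "\<And>y. y \<in> C \<Longrightarrow> real (card {v \<in> I. \<not> E v y}) \<le> d"
    and cd: "c + 2 * d \<le> card C" "d < card I"
  shows "\<exists>f. (\<forall>u\<in>C \<union> U. f u \<in> I \<and> E u (f u)) \<and> (\<forall>i\<in>I. card {u \<in> C \<union> U. f u = i} \<ge> 2)"
proof -
  \<comment> \<open>Each \<open>i\<close> in \<open>I\<close> offers two places for children,
    \<open>(i, True)\<close> and \<open>(i, False)\<close>. A prescribed child \<open>u\<close>
    occupies \<open>(z u, False)\<close>; the open places form \<open>X\<close> and are matched into
    \<open>C\<close>.\<close>
  let ?Z = "(\<lambda>u. (z u, False)) ` U"
  define X where "X = I \<times> UNIV - ?Z"
  have "?Z \<subseteq> I \<times> UNIV" using z(2) by auto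
  moreover have "card ?Z = card U" using z(1) by (intro card_image) (auto simp: inj_on_def)
  ultimately have cX: "card X \<le> card C"
    using size fin unfolding X_def by (subst card_Diff_subset) (auto simp: card_cartesian_product)
  have finX: "finite X" using fin by (simp add: X_def)
  have "\<exists>g. inj_on g X \<and> (\<forall>x\<in>X. g x \<in> C \<and> E (fst x) (g x))"
  \<comment> \<open>The factor two arises because each non-neighbour in \<open>I\<close> accounts
    for up to two places.\<close>
  proof (rule dense_bipartite_matching[where c = c and d = "2 * d"])
    show "finite X" "finite C" "card X \<le> card C" "c + 2 * d \<le> card C"
      using finX fin cX cd by auto
    show "real (card {y \<in> C. \<not> E (fst x) y}) \<le> c" if "x \<in> X" for x
      using that by (intro missI) (auto simp: X_def)
    show "real (card {x \<in> X. \<not> E (fst x) y}) \<le> 2 * d" if "y \<in> C" for y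
    proof -
      have "card {x \<in> X. \<not> E (fst x) y} \<le> card ({v \<in> I. \<not> E v y} \<times> (UNIV :: bool set))"
        using fin(1) by (intro card_mono) (auto simp: X_def)
      then show ?thesis using missC[OF that] by (simp add: card_cartesian_product)
    qed
  qed
  then obtain g where g: "inj_on g X" "\<And>x. x \<in> X \<Longrightarrow> g x \<in> C \<and> E (fst x) (g x)" by auto
  have ex: "\<exists>v\<in>I. E v y" if "y \<in> C" for y
  proof (rule ccontr)
    assume "\<not> ?thesis"
    then have "{v \<in> I. \<not> E v y} = I" by auto
    then show False using missC[OF that] cd(2) by simp
  qed
  \<comment> \<open>Vertices of \<open>C\<close> left over by the matching go to an arbitrary
    neighbour in \<open>I\<close>; further children do no harm.\<close>
  define f where "f u = (if u \<in> U then z u else if u \<in> g ` X then fst (the_inv_into X g u)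
    else (SOME v. v \<in> I \<and> E v u))" for u
  have f_g: "f (g x) = fst x" if "x \<in> X" for x
  proof -
    have "g x \<notin> U" using g(2)[OF that] UC by auto
    then show ?thesis using that g(1) by (simp add: f_def the_inv_into_f_f)
  qed
  have f_z: "f u = z u" if "u \<in> U" for u using that by (simp add: f_def)
  have "f u \<in> I \<and> E u (f u)" if u: "u \<in> C \<union> U" for u
  proof -
    consider "u \<in> U" | x where "x \<in> X" "u = g x" | "u \<in> C" "u \<notin> U" "u \<notin> g ` X"
      using u by blast
    then show ?thesis
    proof cases
      case 1
      then show ?thesis using z(2) f_z by auto
    next
      case 2
      then show ?thesis using g(2)[of x] f_g[of x] sym by (auto simp: X_def dest: sympD)
    next
      case 3
      then have "f u \<in> I \<and> E (f u) u"
        unfolding f_def using ex[of u] someI_ex[of "\<lambda>v. v \<in> I \<and> E v u"] by auto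
      then show ?thesis using sym by (auto dest: sympD)
    qed
  qed
  moreover have "card {u \<in> C \<union> U. f u = i} \<ge> 2" if "i \<in> I" for i
  proof -
    have T: "(i, True) \<in> X" using that by (auto simp: X_def)
    obtain u where u: "u \<in> C \<union> U" "f u = i" "u \<noteq> g (i, True)"
    proof (cases "(i, False) \<in> X")
      case True
      then show ?thesis
        using that g T f_g[of "(i, False)"] inj_onD[OF g(1), of "(i, False)" "(i, True)"]
        by (intro that[of "g (i, False)"]) auto
    next
      case False
      then obtain u where "u \<in> U" "z u = i" using \<open>i \<in> I\<close> by (auto simp: X_def)
      then show ?thesis using g(2)[OF T] UC f_z by (intro that[of u]) auto
    qed
    have "card {u, g (i, True)} \<le> card {u \<in> C \<union> U. f u = i}"
      using u g(2)[OF T] f_g[OF T] fin by (intro card_mono) auto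
    then show ?thesis using u(3) by simp
  qed
  ultimately show ?thesis by blast
qed

text \<open>The tree has depth at most three: below \<open>w\<close> lie the vertices of
  \<open>A\<close> outside \<open>Q\<close> and outside the image of \<open>P\<close> under
  \<open>x\<close>, below \<open>I\<close> all of \<open>B - {w}\<close>, and below each
  \<open>u\<close> in \<open>P\<close> its partner in \<open>Q\<close> together with
  \<open>x u\<close>. The non-leaves are \<open>w\<close>, \<open>I\<close> and
  \<open>P\<close>.\<close>

lemma generalized_Halin_from_bipartition:
  assumes G: "pair_graph G" and V: "pverts G = A \<union> B" "A \<inter> B = {}" and w: "w \<in> B"
    and Q: "Q \<subseteq> A" "\<And>v. v \<in> A - Q \<Longrightarrow> (v, w) \<in> parcs G"
    and p: "bij_betw p Q P" "P \<subseteq> B - {w}" "\<And>v. v \<in> Q \<Longrightarrow> (v, p v) \<in> parcs G"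
    and x: "inj_on x P" "\<And>u. u \<in> P \<Longrightarrow> x u \<in> A - Q - I \<and> (x u, u) \<in> parcs G"
    and I: "I \<subseteq> A - Q"
    and f: "\<And>u. u \<in> B - {w} \<Longrightarrow> f u \<in> I \<and> (u, f u) \<in> parcs G"
      "\<And>i. i \<in> I \<Longrightarrow> card {u \<in> B - {w}. f u = i} \<ge> 2"
    and root: "card (A - Q - x ` P) \<ge> 3"
    and vs: "distinct vs" "length vs \<ge> 3" "set vs = (A - I) \<union> (B - {w} - P)"
      "successively (\<lambda>x y. (x, y) \<in> parcs G) vs" "(last vs, hd vs) \<in> parcs G"
  shows "\<exists>H. spanning_generalized_Halin H G"
proof -
  interpret G: pair_graph G by (rule G)
  define par where "par v = (if v \<in> B then f v else if v \<in> Q then p v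
    else if v \<in> x ` P then the_inv_into P x v else w)" for v
  \<comment> \<open>The rank is the depth in the tree.\<close>
  define rk :: "'a \<Rightarrow> nat" where "rk v = (if v = w then 0 else if v \<in> B then 2
    else if v \<in> Q \<union> x ` P then 3 else 1)" for v
  have AB: "v \<notin> B" if "v \<in> A" for v using that V(2) by auto
  have pP: "p v \<in> P" if "v \<in> Q" for v using that p(1) by (auto simp: bij_betw_def)
  have par_B: "par v = f v" if "v \<in> B" for v using that by (simp add: par_def)
  have par_Q: "par v = p v" if "v \<in> Q" for v using that Q(1) AB by (auto simp: par_def)
  have par_x: "par (x u) = u" if "u \<in> P" for u
    using that x AB[of "x u"] by (auto simp: par_def the_inv_into_f_f)
  have par_w: "par v = w" if "v \<in> A" "v \<notin> Q" "v \<notin> x ` P" for v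
    using that AB by (auto simp: par_def)
  have cases: "v = w \<or> (v \<in> B \<and> v \<noteq> w) \<or> v \<in> Q \<or> (\<exists>u\<in>P. v = x u) \<or> (v \<in> A \<and> v \<notin> Q \<and> v \<notin> x ` P)"
    if "v \<in> A \<union> B" for v using that by auto
  let ?ch = "\<lambda>v. {u \<in> pverts G - {w}. par u = v}"
  have wA: "w \<notin> A" using w V(2) by auto
  have IA: "v \<in> A" "v \<notin> B" "v \<notin> Q" "v \<notin> x ` P" if "v \<in> I" for v
    using that I x(2) AB by auto
  have PB: "v \<in> B" "v \<noteq> w" "v \<notin> A" if "v \<in> P" for v using that p(2) AB by auto
  have wP: "w \<notin> P" using PB(2)[of w] by blast
  have par_A: "par u \<in> P \<union> {w}" if "u \<in> A" for u
    using cases[of u] that pP[of u] par_Q[of u] par_x par_w[of u] wA AB[of u] by auto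
  have ch_I: "?ch v = {u \<in> B - {w}. f u = v}" if "v \<in> I" for v
  proof -
    have "par u \<noteq> v" if "u \<in> A" for u
      using par_A[OF that] IA(1,2)[OF \<open>v \<in> I\<close>] PB(3) wA by blast
    then show ?thesis using V par_B by auto
  qed
  \<comment> \<open>The private vertex \<open>x v\<close> is there because the partner in
    \<open>Q\<close> alone would leave \<open>v\<close> with degree two.\<close>
  have ch_P: "?ch v = {the_inv_into Q p v, x v}" if vP: "v \<in> P" for v
  proof -
    have q: "the_inv_into Q p v \<in> Q" "p (the_inv_into Q p v) = v"
      using p(1) vP by (auto simp: bij_betw_def the_inv_into_into f_the_inv_into_f)
    have "u = the_inv_into Q p v \<or> u = x v" if u: "u \<in> A \<union> B" "u \<noteq> w" "par u = v" for u
    proof -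
      have "u \<notin> B" using u f(1)[of u] par_B[of u] IA(2) PB(1)[OF vP] by auto
      moreover have "u = the_inv_into Q p v" if "u \<in> Q"
        using that par_Q[of u] u(3) p(1) by (auto simp: bij_betw_def the_inv_into_f_f)
      moreover have "u = x v" if "u \<in> x ` P" using that par_x u(3) by auto
      moreover have "u \<in> Q \<or> u \<in> x ` P"
        using par_w[of u] u PB(2)[OF vP] \<open>u \<notin> B\<close> by auto
      ultimately show ?thesis by blast
    qed
    moreover have "the_inv_into Q p v \<in> ?ch v" using q par_Q Q(1) V wA by auto
    moreover have "x v \<in> ?ch v" using par_x[OF vP] x(2)[OF vP] V wA by auto
    ultimately show ?thesis using V(1) by blast
  qed
  have ch_w: "?ch w = A - Q - x ` P"
  proof -
    have "par u \<noteq> w" if "u \<in> B - {w}" for u using f(1)[OF that] par_B[of u] that IA wA by auto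
    moreover have "par u \<noteq> w" if "u \<in> Q" for u using par_Q[OF that] pP[OF that] wP by metis
    moreover have "par u \<noteq> w" if "u \<in> x ` P" for u using that par_x wP by auto
    ultimately show ?thesis using V par_w wA by auto
  qed
  have ch_leaf: "?ch v = {}" if "v \<in> A \<union> B" "v \<noteq> w" "v \<notin> I" "v \<notin> P" for v
  proof -
    have "par u \<in> I \<union> P \<union> {w}" if "u \<in> A \<union> B" "u \<noteq> w" for u
      using cases[OF that(1)] that f(1)[of u] pP[of u] par_Q[of u] par_x par_w[of u] par_B[of u]
      by auto
    then show ?thesis using V(1) that by blast
  qed
  have ch_P2: "card (?ch v) = 2" if "v \<in> P" for v
  proof -
    have "the_inv_into Q p v \<in> Q" using p(1) that by (auto simp: bij_betw_def the_inv_into_into)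
    then have "the_inv_into Q p v \<noteq> x v" using x(2)[OF that] by auto
    then show ?thesis unfolding ch_P[OF that] by simp
  qed
  have arc: "par v \<in> A \<union> B \<and> rk (par v) < rk v \<and> (v, par v) \<in> parcs G"
    if v: "v \<in> A \<union> B" "v \<noteq> w" for v
  proof -
    consider "v \<in> B" "v \<noteq> w" | "v \<in> Q" | u where "u \<in> P" "v = x u" | "v \<in> A" "v \<notin> Q" "v \<notin> x ` P"
      using cases[OF v(1)] v(2) by blast
    then show ?thesis
    proof cases
      case 1
      then show ?thesis using f(1)[of v] par_B IA[of "f v"] wA by (auto simp: rk_def)
    next
      case 2
      then show ?thesis using p(3)[of v] pP[of v] par_Q[of v] PB[of "p v"] Q(1) AB wA
        by (auto simp: rk_def)
    next
      case 3
      then show ?thesis using x(2)[of u] par_x[of u] PB[of u] AB wA by (auto simp: rk_def)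
    next
      case 4
      then show ?thesis using Q(2)[of v] par_w[of v] w AB wA by (auto simp: rk_def)
    qed
  qed
  show ?thesis
  proof (rule generalized_Halin_from_parents[OF G])
    show "rooted_parent (pverts G) w par rk"
      using G.pair_finite_verts w arc V(1) by unfold_locales auto
    show "(v, par v) \<in> parcs G" if "v \<in> pverts G" "v \<noteq> w" for v using that arc V(1) by auto
    show "card (?ch w) \<ge> 3" unfolding ch_w by (rule root)
    show "card (?ch v) \<noteq> 1" if "v \<in> pverts G" "v \<noteq> w" for v
    proof -
      consider "v \<in> I" | "v \<in> P" | "v \<notin> I" "v \<notin> P" by blast
      then show ?thesis
      proof cases
        case 1
        then show ?thesis using f(2)[OF 1] unfolding ch_I[OF 1] by simp
      next
        case 2
        then show ?thesis using ch_P2[OF 2] by simp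
      next
        case 3
        have "v \<in> A \<union> B" using that(1) V(1) by simp
        then have "?ch v = {}" using ch_leaf 3 that(2) by blast
        then show ?thesis by (metis card.empty zero_neq_one)
      qed
    qed
    show "set vs = {v \<in> pverts G - {w}. ?ch v = {}}"
    proof -
      have "?ch v \<noteq> {}" if "v \<in> I" for v using f(2)[OF that] unfolding ch_I[OF that] by (metis card.empty not_numeral_le_zero)
      moreover have "?ch v \<noteq> {}" if "v \<in> P" for v using ch_P[OF that] by simp
      ultimately have "?ch v = {} \<longleftrightarrow> v \<notin> I \<and> v \<notin> P" if "v \<in> A \<union> B" "v \<noteq> w" for v
        using ch_leaf[OF that] by blast
      then have "{v \<in> pverts G - {w}. ?ch v = {}} = {v \<in> A \<union> B - {w}. v \<notin> I \<and> v \<notin> P}"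
        unfolding V(1) by auto
      also have "\<dots> = (A - I) \<union> (B - {w} - P)" using wA IA(2) PB(3) by auto
      finally show ?thesis using vs(3) by simp
    qed
    show "distinct vs" "length vs \<ge> 3" by (fact vs(1), fact vs(2))
    show "successively (\<lambda>x y. (x, y) \<in> parcs G) vs" "(last vs, hd vs) \<in> parcs G"
      by (fact vs(4), fact vs(5))
  qed
qed

section \<open>Almost complete bipartite graphs\<close>

lemma card_set_matching:
  assumes "distinct (concat (map (\<lambda>(x, y). [x, y]) ps))"
  shows "card (set (concat (map (\<lambda>(x, y). [x, y]) ps))) = 2 * length ps"
proof -
  have "length (concat (map (\<lambda>(x, y). [x, y]) ps)) = 2 * length ps" by (induction ps) auto
  then show ?thesis using distinct_card[OF assms] by simp
qed

text \<open>For the blocks that carry a vertex with many non-neighbours between its two private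
  neighbours.\<close>

lemma distinct_concat_triples:
  assumes "distinct bl" "inj_on x (set bl)" "inj_on y (set bl)" "x ` set bl \<inter> y ` set bl = {}"
    "(x ` set bl \<union> y ` set bl) \<inter> set bl = {}"
  shows "distinct (concat (map (\<lambda>u. [x u, u, y u]) bl))"
  using assms
proof (induction bl)
  case (Cons u bl)
  then have "distinct (concat (map (\<lambda>u. [x u, u, y u]) bl))" by auto
  then show ?case using Cons.prems by auto
qed simp

text \<open>
  The hypothesis \<open>size\<close> is what makes the count work: with \<open>card B - 1 - card Q\<close> leaves in \<open>B\<close> and
  \<open>length ps\<close> edges of the cycle inside \<open>A\<close>, the remaining vertices of \<open>A\<close> are inner, and it says
  that \<open>B - {w}\<close> is large enough to give two children to each of them.
\<close>

lemma almost_complete_bipartite_Halin: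
  fixes n :: real
  assumes G: "pair_graph G" and V: "pverts G = A \<union> B" "A \<inter> B = {}" and w: "w \<in> B"
    and n: "n = card (pverts G)" "n \<ge> 10000"
    and missA: "\<And>v. v \<in> A \<Longrightarrow> real (card {u \<in> B. (v, u) \<notin> parcs G}) \<le> n / 30"
    and degB: "\<And>u. u \<in> B \<Longrightarrow> real (card {v \<in> A. (v, u) \<in> parcs G}) \<ge> n / 200"
    and bad: "real (card {u \<in> B. n / 30 < real (card {v \<in> A. (v, u) \<notin> parcs G})}) \<le> n / 10000"
    and Q: "Q = {v \<in> A. (v, w) \<notin> parcs G}" "real (card Q) \<le> n / 10000"
    and ps: "distinct (concat (map (\<lambda>(x, y). [x, y]) ps))"
      "\<forall>(x, y)\<in>set ps. x \<in> A \<and> y \<in> A \<and> (x, y) \<in> parcs G" "real (length ps) \<le> n / 10000"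
    and b: "\<bar>real (card B) - 2 * n / 5\<bar> \<le> n / 1000"
    and size: "2 * card (pverts G) + 3 + 2 * card Q \<le> 2 * length ps + 5 * card B"
  shows "\<exists>H. spanning_generalized_Halin H G"
proof -
  interpret G: pair_graph G by (rule G)
  define E where "E x y \<longleftrightarrow> (x, y) \<in> parcs G" for x y
  have Esym: "E x y \<longleftrightarrow> E y x" for x y using G.arcs_symmetric by (auto simp: E_def)
  then have sympE: "symp E" by (auto simp: symp_def)
  have fin: "finite A" "finite B" using G.pair_finite_verts V(1) by auto
  have ab: "card (pverts G) = card A + card B" using fin V by (simp add: card_Un_disjoint)
  have b_lo: "real (card B) \<ge> 2 * n / 5 - n / 1000" and b_hi: "real (card B) \<le> 2 * n / 5 + n / 1000"
    using b by linarith+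
  have abr: "n = real (card A) + real (card B)" using ab n(1) by linarith
  \<comment> \<open>These vertices violate the degree bounds of the matching lemmas and are placed
    by hand.\<close>
  define Bad where "Bad = {u \<in> B - {w}. n / 30 < real (card {v \<in> A. \<not> E v u})}"
  have "Bad \<subseteq> {u \<in> B. n / 30 < real (card {v \<in> A. (v, u) \<notin> parcs G})}"
    by (auto simp: Bad_def E_def)
  then have "card Bad \<le> card {u \<in> B. n / 30 < real (card {v \<in> A. (v, u) \<notin> parcs G})}"
    using fin by (intro card_mono) auto
  then have cBad: "real (card Bad) \<le> n / 10000" using bad by linarith
  have finBad: "finite Bad" and BadB: "Bad \<subseteq> B - {w}" using fin by (auto simp: Bad_def)
  have QA: "Q \<subseteq> A" using Q(1) by auto
  then have finQ: "finite Q" using fin finite_subset by auto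
  define M where "M = set (concat (map (\<lambda>(x, y). [x, y]) ps))"
  have cM: "card M = 2 * length ps" unfolding M_def by (rule card_set_matching[OF ps(1)])
  have MA: "M \<subseteq> A" using ps(2) by (auto simp: M_def)

  \<comment> \<open>The parents of \<open>Q\<close> become inner vertices, while bad vertices are
    placed on the cycle, so the choice avoids \<open>Bad\<close>. Nearly
    \<open>card B - n / 30\<close> candidates remain, far more than \<open>card Q\<close>.\<close>
  have "\<exists>p. inj_on p Q \<and> (\<forall>v\<in>Q. p v \<in> {u \<in> B. E v u} - insert w Bad)"
  proof (rule inj_choice[OF finQ])
    fix v assume v: "v \<in> Q"
    let ?F = "{u \<in> B. E v u} - insert w Bad" and ?m = "{u \<in> B. (v, u) \<notin> parcs G}"
    show "finite ?F" using fin by auto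
    have "card B \<le> card (?F \<union> (?m \<union> insert w Bad))"
      using fin finBad by (intro card_mono) (auto simp: E_def)
    also have "\<dots> \<le> card ?F + (card ?m + card (insert w Bad))"
      by (intro order_trans[OF card_Un_le] add_left_mono card_Un_le)
    finally have "card B \<le> card ?F + card ?m + Suc (card Bad)"
      using card_insert_le_m1[of "Suc (card Bad)" Bad w] by simp
    then have "real (card B) \<le> real (card ?F) + real (card ?m) + (1 + real (card Bad))" by linarith
    moreover have "real (card ?m) \<le> n / 30" using missA v QA by blast
    ultimately have "real (card Q) \<le> real (card ?F)"
      using cBad Q(2) b_lo n(2) by linarith
    then show "card Q \<le> card ?F" by simp
  qed
  then obtain p where p: "inj_on p Q" "\<And>v. v \<in> Q \<Longrightarrow> p v \<in> B \<and> E v (p v) \<and> p v \<noteq> w \<and> p v \<notin> Bad"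
    by auto
  define P where "P = p ` Q"
  have PB: "P \<subseteq> B - {w}" "P \<inter> Bad = {}" using p(2) by (auto simp: P_def)
  have cP: "card P = card Q" unfolding P_def using p(1) by (rule card_image)
  have finP: "finite P" using finQ by (simp add: P_def)
  \<comment> \<open>The vertices that get private neighbours in \<open>A\<close>: \<open>x u\<close>
    and \<open>y u\<close> next to a bad vertex on the cycle, \<open>x u\<close> as second child of
    a vertex of \<open>P\<close>, and \<open>z u\<close> as parent in both cases.\<close>
  define U where "U = Bad \<union> P"
  have finU: "finite U" using finBad finP by (simp add: U_def)
  have UB: "U \<subseteq> B - {w}" using BadB PB by (auto simp: U_def)
  have cU: "card U = card Bad + card Q"
    unfolding U_def using finBad finP PB(2) cP by (subst card_Un_disjoint) auto

  \<comment> \<open>One injective choice makes all three kinds private at once. Of at least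
    \<open>n / 200\<close> neighbours, \<open>Q\<close> and \<open>M\<close> block at most
    \<open>3 * n / 10000\<close>, and at most \<open>6 * n / 10000\<close> values are wanted in
    total.\<close>
  have "\<exists>c. inj_on c (U \<times> {..<3::nat}) \<and> (\<forall>j\<in>U \<times> {..<3::nat}. c j \<in> {v \<in> A. E v (fst j)} - (Q \<union> M))"
  proof (rule inj_choice)
    show "finite (U \<times> {..<3::nat})" using finU by simp
    fix j assume "j \<in> U \<times> {..<3::nat}"
    then have u: "fst j \<in> B" using UB by auto
    let ?N = "{v \<in> A. E v (fst j)}"
    let ?F = "?N - (Q \<union> M)"
    show "finite ?F" using fin by auto
    have "card ?N \<le> card (?F \<union> (Q \<union> M))"
      using fin finQ MA finite_subset[OF MA] by (intro card_mono) auto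
    also have "\<dots> \<le> card ?F + (card Q + card M)"
      by (intro order_trans[OF card_Un_le] add_left_mono card_Un_le)
    finally have "real (card ?N) \<le> card ?F + card Q + card M" by simp
    moreover have "real (card ?N) \<ge> n / 200" using degB[OF u] by (simp add: E_def)
    ultimately have "3 * real (card U) \<le> real (card ?F)"
      using cBad Q(2) n(2) ps(3) unfolding cM cU of_nat_add of_nat_mult of_nat_numeral by argo
    then show "card (U \<times> {..<3::nat}) \<le> card ?F" by (simp add: card_cartesian_product)
  qed
  then obtain c where c: "inj_on c (U \<times> {..<3::nat})"
    "\<And>u k. u \<in> U \<Longrightarrow> k < 3 \<Longrightarrow> c (u, k) \<in> A \<and> E (c (u, k)) u \<and> c (u, k) \<notin> Q \<and> c (u, k) \<notin> M"
    by fastforce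
  have c_eq: "c (u, k) = c (v, l) \<longleftrightarrow> u = v \<and> k = l" if "u \<in> U" "v \<in> U" "k < 3" "l < 3" for u v k l
    using inj_on_eq_iff[OF c(1), of "(u, k)" "(v, l)"] that by simp
  define x y z where "x u = c (u, 0)" and "y u = c (u, 1)" and "z u = c (u, 2)" for u
  have xyz: "inj_on x U" "inj_on y U" "inj_on z U"
    "x ` U \<inter> y ` U = {}" "x ` U \<inter> z ` U = {}" "y ` U \<inter> z ` U = {}"
    by (auto simp: inj_on_def x_def y_def z_def c_eq)
  have xyz_in: "h u \<in> A \<and> E (h u) u \<and> E u (h u) \<and> h u \<notin> Q \<and> h u \<notin> M" if "u \<in> U" "h \<in> {x, y, z}" for u h
    using that c(2)[of u 0] c(2)[of u 1] c(2)[of u 2] Esym by (auto simp: x_def y_def z_def)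

  let ?D = "A - (Q \<union> M \<union> x ` U \<union> y ` U \<union> z ` U)"
  \<comment> \<open>\<open>i\<close> is the number of inner vertices in \<open>A\<close>. The cycle
    is to have \<open>card A - i\<close> vertices in \<open>A\<close>,
    \<open>card B - 1 - card Q\<close> in \<open>B\<close>, \<open>length ps\<close> edges inside
    \<open>A\<close> and none inside \<open>B\<close>; hence the first number exceeds the second by
    \<open>length ps\<close>.\<close>
  obtain i where i: "i + card B + length ps = card A + 1 + card Q"
  proof -
    have "real (card B + length ps) \<le> real (card A + 1 + card Q)"
      using b_hi ps(3) abr n(2) unfolding of_nat_add of_nat_1 by linarith
    then have "card B + length ps \<le> card A + 1 + card Q" by linarith
    then show thesis using that[of "card A + 1 + card Q - (card B + length ps)"] by simp
  qed
  have ir: "real i = real (card A) + 1 + real (card Q) - real (card B) - real (length ps)"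
    using i by linarith
  have i_lo: "real i \<ge> n / 10" using ir b_hi ps(3) abr n(2) by linarith
  have i_hi: "real i \<le> n / 4" using ir b_lo Q(2) abr n(2) by linarith
  have "real (card U) \<le> real i" using cBad Q(2) i_lo n(2) unfolding cU of_nat_add by linarith
  then have Ui: "card U \<le> i" by simp
  have "i - card U \<le> card ?D"
  proof -
    let ?F = "Q \<union> M \<union> x ` U \<union> y ` U \<union> z ` U"
    have "card A \<le> card (?D \<union> ?F)"
      using fin finQ finU finite_subset[OF MA] by (intro card_mono) auto
    also have "\<dots> \<le> card ?D + card ?F" by (rule card_Un_le)
    also have "card ?F \<le> card Q + card M + card (x ` U) + card (y ` U) + card (z ` U)"
      by (meson add_mono card_Un_le order_refl order_trans)
    finally have "card A \<le> card ?D + (card Q + 2 * length ps + 3 * card U)"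
      using xyz by (simp add: card_image cM)
    then have "real (card A) \<le> real (card ?D) + (real (card Q) + 2 * real (length ps) + 3 * real (card U))"
      by linarith
    then have "real i \<le> real (card ?D)"
      using i_hi b_hi abr Q(2) ps(3) cBad n(2) unfolding cU of_nat_add by argo
    then show ?thesis by linarith
  qed
  then obtain I0 where I0: "I0 \<subseteq> ?D" "card I0 = i - card U" "finite I0"
    by (rule obtain_subset_with_card_n)
  \<comment> \<open>\<open>I0\<close> fills up the prescribed parents to exactly \<open>i\<close>
    vertices, sparing \<open>Q\<close>, the matching and the other private neighbours, which are to
    be leaves.\<close>
  define I where "I = I0 \<union> z ` U"
  have cI: "card I = i"
    unfolding I_def using I0 finU xyz(3) Ui
    by (subst card_Un_disjoint) (auto simp: card_image)
  have finI: "finite I" using I0 finU by (simp add: I_def)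
  have IA: "I \<subseteq> A" "I \<inter> Q = {}" "I \<inter> M = {}" "I \<inter> x ` U = {}" "I \<inter> y ` U = {}"
    using I0(1) xyz xyz_in by (auto simp: I_def)

  define C where "C = B - {w} - U"
  have finC: "finite C" using fin by (simp add: C_def)
  have CU: "C \<union> U = B - {w}" "U \<inter> C = {}" using UB by (auto simp: C_def)
  have "card C + card U = card B - 1"
    using card_Un_disjoint[OF finC finU] CU w fin by (simp add: Int_commute)
  moreover have "card B > 0" using w fin card_gt_0_iff by blast
  ultimately have cC: "card C + card Bad + card Q + 1 = card B" using cU by simp
  have C_lo: "real (card C) \<ge> n / 5"
  proof -
    have "real (card C) + real (card Bad) + real (card Q) + 1 = real (card B)" using cC by linarith
    then show ?thesis using b_lo cBad Q(2) n(2) by linarith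
  qed
  have missC_A: "real (card {y \<in> C. \<not> E v y}) \<le> n / 30" if "v \<in> A" for v
  proof -
    have "card {y \<in> C. \<not> E v y} \<le> card {u \<in> B. (v, u) \<notin> parcs G}"
      using fin by (intro card_mono) (auto simp: C_def E_def)
    then show ?thesis using missA[OF that] by linarith
  qed
  have missA_C: "real (card {v \<in> A. \<not> E v y}) \<le> n / 30" if "y \<in> C" for y
    using that by (auto simp: C_def U_def Bad_def not_less)
  have missI_C: "real (card {v \<in> I. \<not> E v y}) \<le> n / 30" if "y \<in> C" for y
  proof -
    have "card {v \<in> I. \<not> E v y} \<le> card {v \<in> A. \<not> E v y}"
      using fin IA(1) by (intro card_mono) auto
    then show ?thesis using missA_C[OF that] by linarith
  qed

  have "\<exists>f. (\<forall>u\<in>C \<union> U. f u \<in> I \<and> E u (f u)) \<and> (\<forall>i\<in>I. card {u \<in> C \<union> U. f u = i} \<ge> 2)"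
  proof (rule two_children_assignment[where z = z and c = "n / 30" and d = "n / 30"])
    show "z u \<in> I \<and> E u (z u)" if "u \<in> U" for u using xyz_in[OF that, of z] that by (simp add: I_def)
    \<comment> \<open>After substituting for \<open>i\<close> this is precisely the hypothesis
      \<open>size\<close>.\<close>
    show "2 * card I \<le> card C + card U"
      using size i ab cC unfolding cI cU by linarith
    show "n / 30 + 2 * (n / 30) \<le> card C" using C_lo n(2) by simp
    show "n / 30 < card I" using i_lo n(2) cI by simp
    show "real (card {y \<in> C. \<not> E v y}) \<le> n / 30" if "v \<in> I" for v
      using missC_A that IA(1) by auto
  qed (use sympE finI finC finU CU(2) xyz(3) missI_C in auto)
  then obtain f where f: "\<And>u. u \<in> B - {w} \<Longrightarrow> f u \<in> I \<and> E u (f u)"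
    "\<And>i. i \<in> I \<Longrightarrow> card {u \<in> B - {w}. f u = i} \<ge> 2"
    unfolding CU(1) by blast

  obtain bl where bl: "set bl = Bad" "distinct bl" using finite_distinct_list[OF finBad] by blast
  define S where "S = A - I - M - x ` Bad - y ` Bad"
  have "finite S" using fin by (simp add: S_def)
  then obtain sl where sl: "set sl = S" "distinct sl" using finite_distinct_list by blast
  \<comment> \<open>Matching edges, bad vertices between their private neighbours, and the remaining
    leaves of \<open>A\<close> one by one. All block ends lie in \<open>A\<close>, so vertices of
    \<open>C\<close> fit between them.\<close>
  define bs where "bs = map (\<lambda>(x, y). [x, y]) ps @ map (\<lambda>u. [x u, u, y u]) bl @ map (\<lambda>v. [v]) sl"
  have BadU: "Bad \<subseteq> U" by (simp add: U_def)
  have BadA: "Bad \<inter> A = {}" using BadB V(2) by auto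
  have xyBad: "inj_on x Bad" "inj_on y Bad" "x ` Bad \<inter> y ` Bad = {}"
    "x ` Bad \<subseteq> A - I - M" "y ` Bad \<subseteq> A - I - M"
  proof -
    show "inj_on x Bad" "inj_on y Bad"
      using inj_on_subset[OF xyz(1) BadU] inj_on_subset[OF xyz(2) BadU] .
    have sub: "x ` Bad \<subseteq> x ` U" "y ` Bad \<subseteq> y ` U" using BadU by auto
    then show "x ` Bad \<inter> y ` Bad = {}" using xyz(4) by (metis Int_mono bot.extremum_uniqueI)
    have "x u \<notin> I" "y u \<notin> I" if "u \<in> U" for u
      using imageI[OF that, of x] imageI[OF that, of y] IA(4,5) by (metis disjoint_iff)+
    then have "x u \<in> A - I - M" "y u \<in> A - I - M" if "u \<in> U" for u
      using xyz_in[OF that, of x] xyz_in[OF that, of y] that by auto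
    then show "x ` Bad \<subseteq> A - I - M" "y ` Bad \<subseteq> A - I - M"
      using BadU by (auto simp del: Diff_iff)
  qed
  have set_bs: "set (concat bs) = M \<union> (x ` Bad \<union> Bad \<union> y ` Bad) \<union> S"
    unfolding bs_def M_def by (auto simp: bl sl)
  then have set_bs': "set (concat bs) = (A - I) \<union> Bad"
    using MA IA(3) xyBad(4,5) unfolding S_def by blast
  have dist_bs: "distinct (concat bs)"
  proof -
    have "distinct (concat (map (\<lambda>u. [x u, u, y u]) bl))"
      using bl xyBad BadA by (intro distinct_concat_triples) auto
    moreover have "set (concat (map (\<lambda>u. [x u, u, y u]) bl)) = x ` Bad \<union> Bad \<union> y ` Bad"
      by (auto simp: bl)
    moreover have "concat (map (\<lambda>v. [v]) sl) = sl" by (induction sl) auto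
    moreover have "M \<inter> (x ` Bad \<union> Bad \<union> y ` Bad) = {}" "M \<inter> S = {}"
      "(x ` Bad \<union> Bad \<union> y ` Bad) \<inter> S = {}"
      using xyBad(4,5) MA BadA by (auto simp: S_def)
    ultimately show ?thesis
      using ps(1) sl unfolding bs_def M_def by (simp add: Int_Un_distrib del: set_concat)
  qed
  have "card (M \<union> (x ` Bad \<union> y ` Bad)) = 2 * length ps + 2 * card Bad"
  proof -
    have "card (x ` Bad \<union> y ` Bad) = 2 * card Bad"
      using finBad xyBad by (subst card_Un_disjoint) (auto simp: card_image)
    then show ?thesis
      using finBad finite_subset[OF MA fin(1)] xyBad(4,5) cM
      by (subst card_Un_disjoint) auto
  qed
  moreover have "S = A - (I \<union> (M \<union> (x ` Bad \<union> y ` Bad)))" by (auto simp: S_def)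
  moreover have "card (I \<union> (M \<union> (x ` Bad \<union> y ` Bad))) = i + card (M \<union> (x ` Bad \<union> y ` Bad))"
    using finI finBad finite_subset[OF MA fin(1)] xyBad(4,5) IA(3) cI
    by (subst card_Un_disjoint) auto
  moreover have "I \<union> (M \<union> (x ` Bad \<union> y ` Bad)) \<subseteq> A" using IA(1) MA xyBad(4,5) by auto
  ultimately have cS: "card S + (i + (2 * length ps + 2 * card Bad)) = card A"
    using fin(1) by (metis card_Diff_subset card_mono finite_subset le_add_diff_inverse2)
  \<comment> \<open>One vertex of \<open>C\<close> follows each block, and \<open>i\<close> was
    chosen so that the numbers agree.\<close>
  have len_bs: "length bs = card C"
    using cS i cC distinct_card[OF bl(2)] distinct_card[OF sl(2)] by (simp add: bs_def bl sl)

  have "\<exists>vs. distinct vs \<and> set vs = set (concat bs) \<union> C \<and> successively E vs \<and> E (last vs) (hd vs)"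
  proof (rule cycle_through_blocks[where A = A and c = "n / 30" and d = "n / 30"])
    show "set (concat bs) \<inter> C = {}"
      unfolding set_bs' using V(2) BadU by (auto simp: C_def)
    show "bs \<noteq> []" using len_bs C_lo n(2) by auto
    show "2 * (n / 30) + 2 * (n / 30) \<le> card C" using C_lo n(2) by simp
    show "b \<noteq> [] \<and> successively E b \<and> hd b \<in> A \<and> last b \<in> A" if bb: "b \<in> set bs" for b
    proof -
      consider s t where "(s, t) \<in> set ps" "b = [s, t]" | u where "u \<in> Bad" "b = [x u, u, y u]"
        | v where "v \<in> S" "b = [v]"
        using bb by (auto simp: bs_def bl sl)
      then show ?thesis
      proof cases
        case 1
        then show ?thesis using ps(2) by (auto simp: E_def)
      next
        case 2
        then show ?thesis using xyz_in[of u x] xyz_in[of u y] BadU by auto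
      next
        case 3
        then show ?thesis by (auto simp: S_def)
      qed
    qed
  qed (use sympE fin finC dist_bs len_bs missC_A missA_C in auto)
  then obtain vs where vs: "distinct vs" "set vs = (A - I) \<union> Bad \<union> C" "successively E vs"
    "E (last vs) (hd vs)" unfolding set_bs' by blast

  show ?thesis
  proof (rule generalized_Halin_from_bipartition[OF G V w QA, where p = p and P = P and x = x and I = I and f = f])
    show "(v, w) \<in> parcs G" if "v \<in> A - Q" for v using that by (auto simp: Q(1))
    show "bij_betw p Q P" using p(1) by (simp add: bij_betw_def P_def)
    show "P \<subseteq> B - {w}" by (rule PB(1))
    show "(v, p v) \<in> parcs G" if "v \<in> Q" for v using p(2)[OF that] by (simp add: E_def)
    show "inj_on x P" using xyz(1) by (rule inj_on_subset) (simp add: U_def)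
    show "x u \<in> A - Q - I \<and> (x u, u) \<in> parcs G" if "u \<in> P" for u
      using that xyz_in[of u x] IA(4) by (auto simp: U_def E_def)
    show "I \<subseteq> A - Q" using IA by auto
    show "f u \<in> I \<and> (u, f u) \<in> parcs G" if "u \<in> B - {w}" for u using f(1)[OF that] by (simp add: E_def)
    show "card {u \<in> B - {w}. f u = i} \<ge> 2" if "i \<in> I" for i by (rule f(2)[OF that])
    show "card (A - Q - x ` P) \<ge> 3"
    proof -
      have "I \<subseteq> A - Q - x ` P" using IA by (auto simp: U_def)
      then have "card I \<le> card (A - Q - x ` P)" using fin by (intro card_mono) auto
      then show ?thesis using i_lo n(2) cI by linarith
    qed
    show "distinct vs" by (rule vs(1))
    show set_vs: "set vs = A - I \<union> (B - {w} - P)"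
      using vs(2) BadB PB(2) by (auto simp: C_def U_def)
    show "length vs \<ge> 3"
    proof -
      have "card C \<le> card (set vs)" by (rule card_mono[OF finite_set]) (simp add: vs(2))
      then have "card C \<le> length vs" using distinct_card[OF vs(1)] by simp
      then show ?thesis using C_lo n(2) by linarith
    qed
    show "successively (\<lambda>x y. (x, y) \<in> parcs G) vs" "(last vs, hd vs) \<in> parcs G"
      using vs(3,4) unfolding E_def by auto
  qed
qed

section \<open>Counting non-neighbours\<close>

lemma card_filter_add_compl:
  assumes "finite S"
  shows "card {u \<in> S. P u} + card {u \<in> S. \<not> P u} = card S"
proof -
  have "{u \<in> S. P u} \<union> {u \<in> S. \<not> P u} = S" by auto
  moreover have "{u \<in> S. P u} \<inter> {u \<in> S. \<not> P u} = {}" by auto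
  ultimately show ?thesis using assms by (metis card_Un_disjoint finite_Un)
qed

lemma sum_card_swap:
  assumes "finite A" "finite B"
  shows "(\<Sum>v\<in>A. card {u \<in> B. P v u}) = (\<Sum>u\<in>B. card {v \<in> A. P v u})"
proof -
  have "(\<Sum>v\<in>A. card {u \<in> B. P v u}) = (\<Sum>v\<in>A. \<Sum>u\<in>B. if P v u then 1 else 0)"
    using assms(2) by (simp flip: sum.inter_filter)
  also have "\<dots> = (\<Sum>u\<in>B. \<Sum>v\<in>A. if P v u then 1 else 0)" by (rule sum.swap)
  also have "\<dots> = (\<Sum>u\<in>B. card {v \<in> A. P v u})"
    using assms(1) by (simp flip: sum.inter_filter)
  finally show ?thesis .
qed

text \<open>Markov's inequality in counting form; it bounds the number of vertices with many
  non-neighbours.\<close>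

lemma card_le_sum_ge:
  fixes f :: "'a \<Rightarrow> nat" and k :: real
  assumes "finite A" "S \<subseteq> A" "\<And>x. x \<in> S \<Longrightarrow> k \<le> real (f x)"
  shows "real (card S) * k \<le> real (\<Sum>x\<in>A. f x)"
proof -
  have "real (card S) * k = (\<Sum>x\<in>S. k)" by simp
  also have "\<dots> \<le> (\<Sum>x\<in>S. real (f x))" using assms(3) by (rule sum_mono)
  also have "\<dots> \<le> (\<Sum>x\<in>A. real (f x))" using assms(1,2) by (intro sum_mono2) auto
  finally show ?thesis by simp
qed

text \<open>Every edge inside \<open>A\<close> meets \<open>S\<close>, so the degrees of the
  vertices outside \<open>S\<close> are already counted from the side of \<open>S\<close>.\<close>

lemma sum_card_le_incident:
  assumes fin: "finite A" "S \<subseteq> A" and sym: "symp E"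
    and no: "\<And>x y. x \<in> A - S \<Longrightarrow> y \<in> A - S \<Longrightarrow> \<not> E x y"
  shows "(\<Sum>v\<in>A. card {u \<in> A. E v u}) \<le> 2 * (\<Sum>v\<in>S. card {u \<in> A. E v u})"
proof -
  have finS: "finite S" using fin finite_subset by blast
  have "(\<Sum>v\<in>A - S. card {u \<in> A. E v u}) \<le> (\<Sum>v\<in>A - S. card {u \<in> S. E v u})"
    using no finS by (intro sum_mono card_mono) auto
  also have "\<dots> \<le> (\<Sum>v\<in>A. card {u \<in> S. E v u})"
    using fin(1) by (intro sum_mono2) auto
  also have "\<dots> = (\<Sum>u\<in>S. card {v \<in> A. E v u})" by (rule sum_card_swap[OF fin(1) finS])
  also have "\<dots> = (\<Sum>u\<in>S. card {v \<in> A. E u v})"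
  proof -
    have "E v u \<longleftrightarrow> E u v" for v u using sym by (auto dest: sympD)
    then show ?thesis by simp
  qed
  finally have "(\<Sum>v\<in>A - S. card {u \<in> A. E v u}) \<le> (\<Sum>v\<in>S. card {u \<in> A. E v u})" .
  then show ?thesis using sum.subset_diff[OF fin(2,1), of "\<lambda>v. card {u \<in> A. E v u}"] by simp
qed

text \<open>Taking \<open>w\<close> with the fewest non-neighbours keeps
  \<open>card Q * card B\<close> below the number of missing pairs, which makes \<open>Q\<close>
  small. Only the matching inside \<open>A\<close> remains to be supplied; as \<open>w\<close> is
  chosen in the proof, \<open>matching\<close> asks for it in terms of numbers alone.\<close>

lemma Halin_if_matchings:
  fixes n :: real
  assumes G: "pair_graph G" and V: "pverts G = A \<union> B" "A \<inter> B = {}"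
    and n: "n = card (pverts G)" "n \<ge> 100000"
    and missA: "\<And>v. v \<in> A \<Longrightarrow> real (card {u \<in> B. (v, u) \<notin> parcs G}) \<le> n / 30"
    and degB: "\<And>u. u \<in> B \<Longrightarrow> real (card {v \<in> A. (v, u) \<in> parcs G}) \<ge> n / 200"
    and miss: "real (\<Sum>v\<in>A. card {u \<in> B. (v, u) \<notin> parcs G}) \<le> n * n / 500000"
    and b: "real (card B) \<ge> 2 * n / 5 - n / 100000" "real (card B) \<le> 2 * n / 5 + n / 1000"
    and matching: "\<And>q m. q * card B \<le> (\<Sum>v\<in>A. card {u \<in> B. (v, u) \<notin> parcs G}) \<Longrightarrow> m > 0 \<Longrightarrow>
      2 * m + 5 * card B \<le> 2 * card (pverts G) + 4 + 2 * q \<Longrightarrow>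
      \<exists>ps. length ps = m \<and> distinct (concat (map (\<lambda>(x, y). [x, y]) ps)) \<and>
        (\<forall>(x, y)\<in>set ps. x \<in> A \<and> y \<in> A \<and> (x, y) \<in> parcs G)"
  shows "\<exists>H. spanning_generalized_Halin H G"
proof -
  interpret G: pair_graph G by (rule G)
  have fin: "finite A" "finite B" using G.pair_finite_verts V(1) by auto
  let ?T = "\<Sum>v\<in>A. card {u \<in> B. (v, u) \<notin> parcs G}"
  let ?mu = "\<lambda>u. card {v \<in> A. (v, u) \<notin> parcs G}"
  have swap: "?T = (\<Sum>u\<in>B. ?mu u)" by (rule sum_card_swap[OF fin])
  have b3: "real (card B) \<ge> n / 3" using b n(2) by linarith
  then have "B \<noteq> {}" using n(2) by auto
  then obtain w where w: "w \<in> B" "\<And>u. u \<in> B \<Longrightarrow> ?mu w \<le> ?mu u"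
    using arg_min_if_finite(1)[OF fin(2), of ?mu] arg_min_least[OF fin(2), of _ ?mu] that by blast
  define Q where "Q = {v \<in> A. (v, w) \<notin> parcs G}"
  have "card B * card Q \<le> ?T"
    using sum_bounded_below[of B "?mu w" ?mu] w(2) by (simp add: swap Q_def)
  then have qb: "card Q * card B \<le> ?T" by (simp add: mult.commute)
  then have "real (card Q) * real (card B) \<le> n * n / 500000"
    using miss of_nat_mono[OF qb, where 'a = real] by (simp only: of_nat_mult)
  moreover have "real (card Q) * (n / 3) \<le> real (card Q) * real (card B)"
    using b3 by (intro mult_left_mono) auto
  ultimately have "n * real (card Q) \<le> n * (3 * n / 500000)" by argo
  then have q: "real (card Q) \<le> 3 * n / 500000" using n(2) by (simp add: mult_le_cancel_left)
  have bad: "real (card {u \<in> B. n / 30 < real (?mu u)}) \<le> n / 10000"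
  proof -
    have "real (card {u \<in> B. n / 30 < real (?mu u)}) * (n / 30) \<le> real (\<Sum>u\<in>B. ?mu u)"
      using fin(2) by (intro card_le_sum_ge) auto
    then have "n * real (card {u \<in> B. n / 30 < real (?mu u)}) \<le> n * (30 * n / 500000)"
      using miss unfolding swap by argo
    then have "real (card {u \<in> B. n / 30 < real (?mu u)}) \<le> 30 * n / 500000"
      using n(2) by (simp add: mult_le_cancel_left)
    then show ?thesis using n(2) by argo
  qed
  \<comment> \<open>Half of \<open>2 * card (pverts G) + 3 + 2 * card Q - 5 * card B\<close>,
    rounded up: the least matching size that satisfies \<open>size\<close>. Truncated subtraction
    yields \<open>0\<close> when no edge inside \<open>A\<close> is required.\<close>
  define m where "m = (2 * card (pverts G) + 4 + 2 * card Q - 5 * card B) div 2"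
  have size: "2 * card (pverts G) + 3 + 2 * card Q \<le> 2 * m + 5 * card B"
    unfolding m_def by presburger
  have m_hi: "2 * m + 5 * card B \<le> 2 * card (pverts G) + 4 + 2 * card Q" if "m > 0"
    using that unfolding m_def by presburger
  have m: "real m \<le> n / 10000"
  proof (cases "m > 0")
    case True
    then have "2 * real m + 5 * real (card B) \<le> 2 * n + 4 + 2 * real (card Q)"
      using m_hi n(1) by linarith
    then show ?thesis using b(1) q n(2) by argo
  qed (use n(2) in simp)
  obtain ps where ps: "length ps = m" "distinct (concat (map (\<lambda>(x, y). [x, y]) ps))"
    "\<forall>(x, y)\<in>set ps. x \<in> A \<and> y \<in> A \<and> (x, y) \<in> parcs G"
  proof (cases "m > 0")
    case True
    then show thesis using matching[OF qb True m_hi[OF True]] that by blast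
  next
    case False
    then show thesis using that[of "[]"] by simp
  qed
  show ?thesis
  proof (rule almost_complete_bipartite_Halin[OF G V w(1) n(1) _ missA degB bad Q_def _ ps(2,3)])
    show "n \<ge> 10000" using n(2) by simp
    show "real (card Q) \<le> n / 10000" using q n(2) by argo
    show "real (length ps) \<le> n / 10000" using m ps(1) by simp
    show "\<bar>real (card B) - 2 * n / 5\<bar> \<le> n / 1000" using b n(2) by linarith
    show "2 * card (pverts G) + 3 + 2 * card Q \<le> 2 * length ps + 5 * card B" using size ps(1) by simp
  qed
qed

lemma degree_pair_graph:
  assumes "pair_graph G"
  shows "degree G v = card {u \<in> pverts G. (v, u) \<in> parcs G}"
proof -
  interpret G: pair_graph G by fact
  have "out_arcs (with_proj G) v = Pair v ` {u \<in> pverts G. (v, u) \<in> parcs G}"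
    by (auto simp: out_arcs_def dest: G.in_arcsD2)
  then show ?thesis by (simp add: degree_def out_degree_def card_image inj_on_def)
qed

lemma min_degree_le:
  assumes "pair_graph G" "v \<in> pverts G"
  shows "min_degree G \<le> card {u \<in> pverts G. (v, u) \<in> parcs G}"
proof -
  interpret G: pair_graph G by fact
  show ?thesis
    unfolding min_degree_def degree_pair_graph[OF assms(1), symmetric]
    using assms(2) G.pair_finite_verts by (intro Min_le) auto
qed

section \<open>The partition\<close>

text \<open>Fewer than \<open>2 * m\<close> vertices cannot cover all vertices of high degree, nor
  all neighbours of one that they miss; so an edge avoids them.\<close>

lemma matching_of_many_high_degree:
  assumes X: "2 * m \<le> card {v \<in> A. 2 * m \<le> card {u \<in> A. E v u}}"
    and irr: "\<And>v. \<not> E v v"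
  shows "\<exists>ps. length ps = m \<and> distinct (concat (map (\<lambda>(x, y). [x, y]) ps)) \<and>
    (\<forall>(x, y)\<in>set ps. x \<in> A \<and> y \<in> A \<and> E x y)"
proof (rule greedy_matching)
  fix S assume S: "S \<subseteq> A" "finite S" "card S < 2 * m"
  have "\<not> {v \<in> A. 2 * m \<le> card {u \<in> A. E v u}} \<subseteq> S"
    using card_mono[OF S(2)] X S(3) by (meson leD order_trans)
  then obtain v where v: "v \<in> A - S" "2 * m \<le> card {u \<in> A. E v u}" by auto
  have "\<not> {u \<in> A. E v u} \<subseteq> S"
    using card_mono[OF S(2)] v(2) S(3) by (meson leD order_trans)
  then obtain u where "u \<in> A - S" "E v u" by auto
  then show "\<exists>x\<in>A - S. \<exists>y\<in>A - S. x \<noteq> y \<and> E x y" using v(1) irr by metis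
qed

text \<open>If every edge meets \<open>S\<close>, the degree sum is at most
  \<open>2 * card S * k\<close>, which \<open>many\<close> forbids because
  \<open>card S \<le> 2 * m - 1\<close>.\<close>

lemma matching_of_low_degree:
  fixes k :: real
  assumes fin: "finite A" and sym: "symp E" and irr: "\<And>v. \<not> E v v"
    and k: "k \<ge> 0" and low: "\<And>v. v \<in> A \<Longrightarrow> real (card {u \<in> A. E v u}) \<le> k"
    and many: "2 * real (2 * m - 1) * k < real (\<Sum>v\<in>A. card {u \<in> A. E v u})"
  shows "\<exists>ps. length ps = m \<and> distinct (concat (map (\<lambda>(x, y). [x, y]) ps)) \<and>
    (\<forall>(x, y)\<in>set ps. x \<in> A \<and> y \<in> A \<and> E x y)"
proof (rule greedy_matching)
  fix S assume S: "S \<subseteq> A" "finite S" "card S < 2 * m"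
  show "\<exists>x\<in>A - S. \<exists>y\<in>A - S. x \<noteq> y \<and> E x y"
  proof (rule ccontr)
    assume "\<not> ?thesis"
    then have "\<not> E x y" if "x \<in> A - S" "y \<in> A - S" for x y
      using that irr by metis
    then have "(\<Sum>v\<in>A. card {u \<in> A. E v u}) \<le> 2 * (\<Sum>v\<in>S. card {u \<in> A. E v u})"
      by (rule sum_card_le_incident[OF fin S(1) sym])
    then have "real (\<Sum>v\<in>A. card {u \<in> A. E v u}) \<le> 2 * (\<Sum>v\<in>S. real (card {u \<in> A. E v u}))"
      using of_nat_mono[where 'a = real] by fastforce
    also have "(\<Sum>v\<in>S. real (card {u \<in> A. E v u})) \<le> (\<Sum>v\<in>S. k)"
      using low S(1) by (intro sum_mono) auto
    also have "(\<Sum>v\<in>S. k) = real (card S) * k" by simp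
    also have "real (card S) * k \<le> real (2 * m - 1) * k"
      using S(3) k by (intro mult_right_mono) auto
    finally show False using many by (simp add: mult.assoc)
  qed
qed

text \<open>The set \<open>X\<close> of vertices with at least \<open>n / 100\<close> neighbours
  inside \<open>A\<close> decides. If it is large, it yields a matching greedily. If it is small, it
  moves to \<open>B\<close> at little cost, and the remaining side has such low inner degrees that
  its degree sum forces a large matching.\<close>

lemma Halin_of_almost_complete_partition:
  fixes n \<alpha> :: real
  assumes G: "pair_graph G" and V: "pverts G = A \<union> B" "A \<inter> B = {}"
    and n: "n = card (pverts G)" "\<alpha> * n \<ge> 100" and \<alpha>: "0 < \<alpha>" "\<alpha> \<le> 1 / 10 ^ 8"
    and mindeg: "\<And>v. v \<in> pverts G \<Longrightarrow> (2 * n + 3) / 5 \<le> real (card {u \<in> pverts G. (v, u) \<in> parcs G})"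
    and b: "real (card B) \<ge> 2 * n / 5 - 5 * (\<alpha> * n)" "real (card B) \<le> 2 * n / 5 + \<alpha> * n"
    and missA: "\<And>v. v \<in> A \<Longrightarrow> real (card {u \<in> B. (v, u) \<notin> parcs G}) \<le> n / 50"
    and degB: "\<And>u. u \<in> B \<Longrightarrow> real (card {v \<in> A. (v, u) \<in> parcs G}) \<ge> n / 100"
    and miss: "real (\<Sum>v\<in>A. card {u \<in> B. (v, u) \<notin> parcs G}) \<le> 3 * (\<alpha> * n) * n"
  shows "\<exists>H. spanning_generalized_Halin H G"
proof -
  interpret G: pair_graph G by (rule G)
  define E where "E x y \<longleftrightarrow> (x, y) \<in> parcs G" for x y
  have Esym: "E x y \<longleftrightarrow> E y x" for x y using G.arcs_symmetric by (auto simp: E_def)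
  then have sympE: "symp E" by (auto simp: symp_def)
  have irr: "\<not> E x x" for x using G.no_loops' by (auto simp: E_def)
  have fin: "finite A" "finite B" using G.pair_finite_verts V(1) by auto
  have "card (pverts G) = card A + card B" using fin V by (simp add: card_Un_disjoint)
  then have ab: "n = real (card A) + real (card B)" using n(1) by simp
  have n_pos: "n > 0" using n(2) \<alpha>(1) by (metis less_le_trans zero_less_mult_pos zero_less_numeral)
  have an: "\<alpha> * n \<le> n / 10 ^ 8" using \<alpha>(2) n_pos mult_right_mono[of \<alpha> "1 / 10 ^ 8" n] by simp
  then have an': "\<alpha> * n * 100000000 \<le> n" by (simp add: field_simps)
  have n_big: "n \<ge> 10000000000" using an' n(2) by linarith
  have sq: "\<alpha> * n * n * 100000000 \<le> n * n"
    using mult_right_mono[OF an', of n] n_pos by (simp add: mult_ac)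
  define X where "X = {v \<in> A. n / 100 \<le> real (card {u \<in> A. E v u})}"
  have XA: "X \<subseteq> A" by (auto simp: X_def)
  have finX: "finite X" using XA fin(1) finite_subset by blast
  show ?thesis
  proof (cases "100 * (\<alpha> * n) \<le> real (card X)")
    case True
    show ?thesis
    proof (rule Halin_if_matchings[OF G V n(1)])
      show "n \<ge> 100000" using n_big by simp
      show "real (card {u \<in> B. (v, u) \<notin> parcs G}) \<le> n / 30" if "v \<in> A" for v
        using missA[OF that] n_pos by argo
      show "n / 200 \<le> real (card {v \<in> A. (v, u) \<in> parcs G})" if "u \<in> B" for u
        using degB[OF that] n_pos by argo
      show "real (\<Sum>v\<in>A. card {u \<in> B. (v, u) \<notin> parcs G}) \<le> n * n / 500000"
        using miss sq n_pos mult_pos_pos[OF n_pos n_pos] by argo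
      show "2 * n / 5 - n / 100000 \<le> real (card B)" "real (card B) \<le> 2 * n / 5 + n / 1000"
        using b an' n_pos by argo+
      fix q m :: nat
      assume q: "q * card B \<le> (\<Sum>v\<in>A. card {u \<in> B. (v, u) \<notin> parcs G})"
        and m: "2 * m + 5 * card B \<le> 2 * card (pverts G) + 4 + 2 * q"
      have b3: "n / 3 \<le> real (card B)" using b(1) an' n_pos by argo
      have "real q * real (card B) \<le> 3 * (\<alpha> * n) * n"
        using miss of_nat_mono[OF q, where 'a = real] by (simp only: of_nat_mult)
      moreover have "real q * (n / 3) \<le> real q * real (card B)"
        using b3 by (intro mult_left_mono) auto
      ultimately have "n * real q \<le> n * (9 * (\<alpha> * n))" by argo
      then have q': "real q \<le> 9 * (\<alpha> * n)" using n_pos by (simp add: mult_le_cancel_left)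
      have "2 * real m + 5 * real (card B) \<le> 2 * n + 4 + 2 * real q" using m n(1) by linarith
      \<comment> \<open>Five times the deviation of \<open>card B\<close> gives 25 and
        \<open>2 * q\<close> gives 18; the additive 4 is absorbed by one more
        \<open>\<alpha> * n\<close>.\<close>
      then have m': "2 * real m \<le> 44 * (\<alpha> * n)" using b(1) q' n(2) by argo
      have "{v \<in> A. 2 * m \<le> card {u \<in> A. E v u}} \<supseteq> X"
      proof -
        have "2 * m \<le> card {u \<in> A. E v u}" if "n / 100 \<le> real (card {u \<in> A. E v u})" for v
        proof -
          have "2 * real m \<le> real (card {u \<in> A. E v u})" using that m' an' n_pos by argo
          then show ?thesis by linarith
        qed
        then show ?thesis by (auto simp: X_def)
      qed
      then have "card X \<le> card {v \<in> A. 2 * m \<le> card {u \<in> A. E v u}}"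
        using fin(1) by (intro card_mono) auto
      moreover have "2 * m \<le> card X"
      proof -
        have "2 * real m \<le> real (card X)" using True m' n(2) by argo
        then show ?thesis by linarith
      qed
      ultimately show "\<exists>ps. length ps = m \<and> distinct (concat (map (\<lambda>(x, y). [x, y]) ps)) \<and>
          (\<forall>(x, y)\<in>set ps. x \<in> A \<and> y \<in> A \<and> (x, y) \<in> parcs G)"
        using matching_of_many_high_degree[of m A E] irr unfolding E_def by simp
    qed
  next
    case False
    then have cX: "real (card X) \<le> 100 * (\<alpha> * n)" by simp
    define A' B' where "A' = A - X" and "B' = B \<union> X"
    have V': "pverts G = A' \<union> B'" "A' \<inter> B' = {}" using V XA by (auto simp: A'_def B'_def)
    have fin': "finite A'" "finite B'" using fin finX by (auto simp: A'_def B'_def)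
    have "card B' = card B + card X"
      unfolding B'_def using fin finX XA V(2) by (intro card_Un_disjoint) auto
    then have b': "real (card B') = real (card B) + real (card X)" by simp
    have "card (pverts G) = card A' + card B'" using fin' V' by (simp add: card_Un_disjoint)
    then have ab': "n = real (card A') + real (card B')" using n(1) by simp
    have missA': "card {u \<in> B'. \<not> E v u} \<le> card {u \<in> B. \<not> E v u} + card X" for v
    proof -
      have "card {u \<in> B'. \<not> E v u} \<le> card ({u \<in> B. \<not> E v u} \<union> X)"
        using fin finX by (intro card_mono) (auto simp: B'_def)
      then show ?thesis using card_Un_le order_trans by blast
    qed
    let ?T = "\<Sum>v\<in>A'. card {u \<in> B'. \<not> E v u}"
    \<comment> \<open>The old missing pairs contribute 3, the new ones with \<open>X\<close> at most
      100.\<close>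
    have T: "real ?T \<le> 103 * (\<alpha> * n) * n"
    proof -
      have "?T \<le> (\<Sum>v\<in>A'. card {u \<in> B. \<not> E v u} + card X)" using missA' by (rule sum_mono)
      also have "\<dots> = (\<Sum>v\<in>A'. card {u \<in> B. \<not> E v u}) + card A' * card X" by (simp add: sum.distrib)
      also have "(\<Sum>v\<in>A'. card {u \<in> B. \<not> E v u}) \<le> (\<Sum>v\<in>A. card {u \<in> B. \<not> E v u})"
        using fin(1) by (intro sum_mono2) (auto simp: A'_def)
      finally have "real ?T \<le> real (\<Sum>v\<in>A. card {u \<in> B. \<not> E v u}) + real (card A') * real (card X)"
        by (simp only: flip: of_nat_add of_nat_mult) (simp only: of_nat_le_iff)
      moreover have "real (card A') * real (card X) \<le> n * (100 * (\<alpha> * n))"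
        using cX ab' n_pos by (intro mult_mono) auto
      ultimately show ?thesis using miss unfolding E_def by argo
    qed
    show ?thesis
    proof (rule Halin_if_matchings[OF G V' n(1)])
      show "n \<ge> 100000" using n_big by simp
      show "real (card {u \<in> B'. (v, u) \<notin> parcs G}) \<le> n / 30" if "v \<in> A'" for v
      proof -
        have "real (card {u \<in> B'. \<not> E v u}) \<le> real (card {u \<in> B. \<not> E v u}) + real (card X)"
          using missA'[of v] by linarith
        moreover have "v \<in> A" using that by (simp add: A'_def)
        ultimately show ?thesis using missA[of v] cX an' n_pos unfolding E_def by argo
      qed
      show "n / 200 \<le> real (card {v \<in> A'. (v, u) \<in> parcs G})" if "u \<in> B'" for u
      proof -
        have "n / 100 \<le> real (card {v \<in> A. E v u})"
          using that degB[of u] by (auto simp: B'_def X_def E_def[symmetric] Esym[of u])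
        moreover have "card {v \<in> A. E v u} \<le> card ({v \<in> A'. E v u} \<union> X)"
          using fin' finX by (intro card_mono) (auto simp: A'_def)
        then have "card {v \<in> A. E v u} \<le> card {v \<in> A'. E v u} + card X"
          using card_Un_le order_trans by blast
        then have "real (card {v \<in> A. E v u}) \<le> real (card {v \<in> A'. E v u}) + real (card X)" by linarith
        ultimately show ?thesis using cX an' n_pos unfolding E_def by argo
      qed
      show "real (\<Sum>v\<in>A'. card {u \<in> B'. (v, u) \<notin> parcs G}) \<le> n * n / 500000"
        using T sq mult_pos_pos[OF n_pos n_pos] unfolding E_def by argo
      show b'_bounds: "2 * n / 5 - n / 100000 \<le> real (card B')" "real (card B') \<le> 2 * n / 5 + n / 1000"
        using b b' cX an' n_pos of_nat_0_le_iff[of "card X", where 'a = real] by argo+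
      fix q m :: nat
      assume q: "q * card B' \<le> (\<Sum>v\<in>A'. card {u \<in> B'. (v, u) \<notin> parcs G})" and m0: "m > 0"
        and m: "2 * m + 5 * card B' \<le> 2 * card (pverts G) + 4 + 2 * q"
      let ?D = "real (\<Sum>v\<in>A'. card {u \<in> A'. E v u})"
      \<comment> \<open>A vertex of \<open>A'\<close> joined to all of \<open>B'\<close> still needs
        \<open>t\<close> neighbours in \<open>A'\<close>, and each non-neighbour in
        \<open>B'\<close> adds one to this. Summing over \<open>A'\<close> gives \<open>D\<close>
        below; \<open>t\<close> may be negative.\<close>
      define t where "t = (2 * n + 3) / 5 - real (card B')"
      have D: "real (card A') * t + real q * real (card B') \<le> ?D"
      proof -
        have "t + real (card {u \<in> B'. \<not> E v u}) \<le> real (card {u \<in> A'. E v u})" if "v \<in> A'" for v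
        proof -
          have "{u \<in> pverts G. E v u} = {u \<in> A'. E v u} \<union> {u \<in> B'. E v u}" using V' by auto
          then have "real (card {u \<in> pverts G. E v u}) = real (card {u \<in> A'. E v u}) + real (card {u \<in> B'. E v u})"
            using fin' V'(2) by (simp add: card_Un_disjoint disjoint_iff)
          moreover have "real (card {u \<in> B'. E v u}) + real (card {u \<in> B'. \<not> E v u}) = real (card B')"
            unfolding of_nat_add[symmetric] card_filter_add_compl[OF fin'(2)] ..
          moreover have "(2 * n + 3) / 5 \<le> real (card {u \<in> pverts G. E v u})"
            using mindeg[of v] that V' unfolding E_def by simp
          ultimately show ?thesis unfolding t_def by argo
        qed
        then have "(\<Sum>v\<in>A'. t + real (card {u \<in> B'. \<not> E v u})) \<le> (\<Sum>v\<in>A'. real (card {u \<in> A'. E v u}))"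
          by (rule sum_mono)
        then have "real (card A') * t + real ?T \<le> ?D" by (simp add: sum.distrib)
        moreover have "real q * real (card B') \<le> real ?T"
          using of_nat_mono[OF q, where 'a = real] unfolding E_def by (simp only: of_nat_mult)
        ultimately show ?thesis by linarith
      qed
      have D0: "?D \<ge> 0" by (rule of_nat_0_le_iff)
      have a_lo: "real (card A') \<ge> n / 2" and a_hi: "real (card A') \<le> 5 / 2 * real (card B')"
        and b_lo: "real (card B') \<ge> n / 3"
        using ab' b'_bounds n_pos by argo+
      \<comment> \<open>The quantity \<open>5 * t + 2 * q\<close> is what bounds
        \<open>2 * m - 1\<close>. For \<open>t \<ge> 0\<close> both summands of \<open>D\<close> are
        estimated separately. For negative \<open>t\<close> the bound
        \<open>card A' \<le> 5 / 2 * card B'\<close> lets \<open>card B'\<close> be factored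
        out.\<close>
      have key: "n * (5 * t + 2 * real q) \<le> 16 * ?D"
      proof (cases "t \<ge> 0")
        case True
        have "n / 2 * t \<le> real (card A') * t" "real q * (n / 3) \<le> real q * real (card B')"
          using mult_right_mono[OF a_lo True] mult_left_mono[OF b_lo of_nat_0_le_iff] by blast+
        moreover have "0 \<le> n / 2 * t" "0 \<le> real q * (n / 3)" using True n_pos by auto
        ultimately show ?thesis using D by argo
      next
        case False
        let ?b = "real (card B')"
        have "5 / 2 * ?b * t \<le> real (card A') * t" using False a_hi by (intro mult_right_mono_neg) auto
        then have "?b * (5 * t + 2 * real q) \<le> 2 * ?D" using D by argo
        moreover have "n * (5 * t + 2 * real q) \<le> 16 * ?D" if "5 * t + 2 * real q > 0"
        proof -
          have "n / 3 * (5 * t + 2 * real q) \<le> ?b * (5 * t + 2 * real q)"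
            using that b_lo by (intro mult_right_mono) auto
          then show ?thesis using calculation D0 by argo
        qed
        moreover have "n * (5 * t + 2 * real q) \<le> 0" if "\<not> 5 * t + 2 * real q > 0"
          using that n_pos by (simp add: mult_nonneg_nonpos)
        ultimately show ?thesis using D0 by linarith
      qed
      have "2 * real m + 5 * real (card B') \<le> 2 * n + 4 + 2 * real q" using m n(1) by linarith
      moreover have "real (2 * m - 1) = 2 * real m - 1" using m0 by (simp add: of_nat_diff)
      \<comment> \<open>The 4 from rounding, less the 1 subtracted from \<open>2 * m\<close>, is
        exactly the 3 of the minimum degree condition.\<close>
      ultimately have m': "real (2 * m - 1) \<le> 5 * t + 2 * real q" unfolding t_def by argo
      have "n * real (2 * m - 1) \<le> 16 * ?D"
        using mult_left_mono[OF m' less_imp_le[OF n_pos]] key by (rule order_trans)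
      moreover have "n * real (2 * m - 1) > 0" using m0 n_pos by simp
      \<comment> \<open>Here the threshold \<open>n / 100\<close> for \<open>X\<close> enters: the
        factor \<open>2 * 16 / 100\<close> is below one, and \<open>m > 0\<close> makes the
        inequality strict.\<close>
      ultimately have many: "2 * real (2 * m - 1) * (n / 100) < ?D" by argo
      show "\<exists>ps. length ps = m \<and> distinct (concat (map (\<lambda>(x, y). [x, y]) ps)) \<and>
          (\<forall>(x, y)\<in>set ps. x \<in> A' \<and> y \<in> A' \<and> (x, y) \<in> parcs G)"
        unfolding E_def[symmetric]
      proof (rule matching_of_low_degree[OF fin'(1) sympE irr _ _ many])
        show "0 \<le> n / 100" using n_pos by simp
        fix v assume v: "v \<in> A'"
        have "card {u \<in> A'. E v u} \<le> card {u \<in> A. E v u}"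
          using fin(1) by (intro card_mono) (auto simp: A'_def)
        moreover have "real (card {u \<in> A. E v u}) < n / 100" using v by (auto simp: A'_def X_def)
        ultimately show "real (card {u \<in> A'. E v u}) \<le> n / 100" by linarith
      qed
    qed
  qed
qed

text \<open>A vertex of \<open>V2\<close> with few neighbours in \<open>V1\<close> has most of its
  neighbours in \<open>V2\<close>, so it behaves like a vertex of the large side and is moved there.
  Such vertices miss most of \<open>V1\<close>, hence they are few.\<close>

lemma Halin_near_extremal:
  fixes n \<alpha> :: real
  assumes G: "pair_graph G" and V: "V1 \<union> V2 = pverts G" "V1 \<inter> V2 = {}"
    and n: "n = card (pverts G)" "\<alpha> * n \<ge> 100" and \<alpha>: "0 < \<alpha>" "\<alpha> \<le> 1 / 10 ^ 8"
    and mindeg: "\<And>v. v \<in> pverts G \<Longrightarrow> (2 * n + 3) / 5 \<le> real (card {u \<in> pverts G. (v, u) \<in> parcs G})"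
    and V1: "real (card V1) > (3 / 5 - \<alpha>) * n"
    and deg: "\<And>v. v \<in> V1 \<Longrightarrow> real (card {u \<in> V2. (v, u) \<in> parcs G}) \<ge> (2 * n + 3) / 5 - \<alpha> * n"
  shows "\<exists>H. spanning_generalized_Halin H G"
proof -
  interpret G: pair_graph G by (rule G)
  define E where "E x y \<longleftrightarrow> (x, y) \<in> parcs G" for x y
  have Esym: "E x y \<longleftrightarrow> E y x" for x y using G.arcs_symmetric by (auto simp: E_def)
  have fin: "finite V1" "finite V2" using G.pair_finite_verts V(1) by (metis finite_Un)+
  have "card (pverts G) = card V1 + card V2" using fin V by (metis card_Un_disjoint)
  then have nn: "n = real (card V1) + real (card V2)" using n(1) by simp
  have n_pos: "n > 0" using n(2) \<alpha>(1) by (metis less_le_trans zero_less_mult_pos zero_less_numeral)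
  have an: "\<alpha> * n \<le> n / 10 ^ 8" using \<alpha>(2) n_pos mult_right_mono[of \<alpha> "1 / 10 ^ 8" n] by simp
  then have an': "\<alpha> * n * 100000000 \<le> n" by (simp add: field_simps)
  have n1: "real (card V1) \<ge> 3 / 5 * n - \<alpha> * n" using V1 by (simp add: left_diff_distrib)
  have miss1: "real (card {u \<in> V2. \<not> E v u}) \<le> 2 * (\<alpha> * n)" if "v \<in> V1" for v
  proof -
    have "real (card {u \<in> V2. E v u}) + real (card {u \<in> V2. \<not> E v u}) = real (card V2)"
      using card_filter_add_compl[OF fin(2), of "E v"] by linarith
    then show ?thesis using deg[OF that] n1 nn unfolding E_def by argo
  qed
  define W where "W = {u \<in> V2. real (card {v \<in> V1. E v u}) < n / 100}"
  have WV: "W \<subseteq> V2" by (auto simp: W_def)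
  have finW: "finite W" using WV fin(2) finite_subset by blast
  have sum1: "real (\<Sum>v\<in>V1. card {u \<in> V2. \<not> E v u}) \<le> real (card V1) * (2 * (\<alpha> * n))"
  proof -
    have "(\<Sum>v\<in>V1. real (card {u \<in> V2. \<not> E v u})) \<le> (\<Sum>v\<in>V1. 2 * (\<alpha> * n))"
      using miss1 by (rule sum_mono)
    then show ?thesis by simp
  qed
  \<comment> \<open>Each vertex of \<open>W\<close> misses at least \<open>n / 2\<close> vertices of
    \<open>V1\<close>, while at most \<open>2 * (\<alpha> * n) * n\<close> pairs are
    missing.\<close>
  have cW: "real (card W) \<le> 4 * (\<alpha> * n)"
  proof -
    have "real (card W) * (n / 2) \<le> real (\<Sum>u\<in>V2. card {v \<in> V1. \<not> E v u})"
    proof (rule card_le_sum_ge[OF fin(2) WV])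
      fix u assume "u \<in> W"
      then have "real (card {v \<in> V1. E v u}) < n / 100" by (simp add: W_def)
      then show "n / 2 \<le> real (card {v \<in> V1. \<not> E v u})"
        using card_filter_add_compl[OF fin(1), of "\<lambda>v. E v u"] n1 an' n_pos by linarith
    qed
    also have "\<dots> = real (\<Sum>v\<in>V1. card {u \<in> V2. \<not> E v u})" by (simp only: sum_card_swap[OF fin])
    also have "\<dots> \<le> n * (2 * (\<alpha> * n))"
      using sum1 nn n(2) by (elim order_trans) (intro mult_right_mono, auto)
    finally have "n * real (card W) \<le> n * (4 * (\<alpha> * n))" by argo
    then show ?thesis using n_pos by (simp add: mult_le_cancel_left)
  qed
  define A B where "A = V1 \<union> W" and "B = V2 - W"
  have V': "pverts G = A \<union> B" "A \<inter> B = {}" using V WV by (auto simp: A_def B_def)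
  have finAB: "finite A" "finite B" using fin finW by (auto simp: A_def B_def)
  have cB: "real (card B) = real (card V2) - real (card W)"
    unfolding B_def using WV fin(2) finW by (simp add: card_Diff_subset card_mono of_nat_diff)
  have "V1 \<noteq> {}" using n1 an' n_pos by auto
  then obtain v1 where "v1 \<in> V1" by blast
  then have n2: "real (card V2) \<ge> 2 / 5 * n - \<alpha> * n"
  proof -
    have "real (card {u \<in> V2. E v1 u}) \<le> real (card V2)"
      using fin(2) by (intro of_nat_mono card_mono) auto
    then show ?thesis using deg[OF \<open>v1 \<in> V1\<close>] unfolding E_def by argo
  qed
  have missB: "card {u \<in> B. \<not> E v u} \<le> card {u \<in> V2. \<not> E v u}" for v
    using fin(2) by (intro card_mono) (auto simp: B_def)
  \<comment> \<open>Less than \<open>n / 100\<close> of the minimum degree goes to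
    \<open>V1\<close>, and \<open>card V2\<close> exceeds \<open>2 * n / 5\<close> by at most
    \<open>\<alpha> * n\<close>.\<close>
  have missW: "real (card {u \<in> V2. \<not> E v u}) \<le> n / 50" if "v \<in> W" for v
  proof -
    have "{u \<in> pverts G. E v u} = {u \<in> V1. E v u} \<union> {u \<in> V2. E v u}" using V(1) by auto
    then have "real (card {u \<in> pverts G. E v u}) = real (card {u \<in> V1. E v u}) + real (card {u \<in> V2. E v u})"
      using fin V(2) by (simp add: card_Un_disjoint disjoint_iff)
    moreover have "real (card {u \<in> V1. E v u}) < n / 100" using that by (simp add: W_def Esym[of v])
    moreover have "(2 * n + 3) / 5 \<le> real (card {u \<in> pverts G. E v u})"
      using mindeg[of v] that WV V(1) unfolding E_def by auto
    moreover have "real (card V2) \<le> 2 / 5 * n + \<alpha> * n" using nn n1 by argo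
    moreover have "real (card {u \<in> V2. E v u}) + real (card {u \<in> V2. \<not> E v u}) = real (card V2)"
      unfolding of_nat_add[symmetric] card_filter_add_compl[OF fin(2)] ..
    ultimately show ?thesis using an' n_pos by argo
  qed
  show ?thesis
  proof (rule Halin_of_almost_complete_partition[OF G V' n \<alpha> mindeg])
    show "2 * n / 5 - 5 * (\<alpha> * n) \<le> real (card B)" using cB cW n2 by argo
    show "real (card B) \<le> 2 * n / 5 + \<alpha> * n" using cB nn n1 by linarith
    show "real (card {u \<in> B. (v, u) \<notin> parcs G}) \<le> n / 50" if "v \<in> A" for v
    proof -
      have "real (card {u \<in> B. \<not> E v u}) \<le> real (card {u \<in> V2. \<not> E v u})" using missB[of v] by simp
      moreover have "real (card {u \<in> V2. \<not> E v u}) \<le> n / 50"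
      proof (cases "v \<in> V1")
        case True
        then show ?thesis using miss1[OF True] an' n_pos by argo
      next
        case False
        then show ?thesis using missW that by (auto simp: A_def)
      qed
      ultimately show ?thesis unfolding E_def by linarith
    qed
    show "n / 100 \<le> real (card {v \<in> A. (v, u) \<in> parcs G})" if "u \<in> B" for u
    proof -
      have "n / 100 \<le> real (card {v \<in> V1. E v u})" using that by (simp add: B_def W_def not_less)
      also have "\<dots> \<le> real (card {v \<in> A. E v u})"
        using finAB by (intro of_nat_mono card_mono) (auto simp: A_def)
      finally show ?thesis by (simp add: E_def)
    qed
    \<comment> \<open>The vertices of \<open>V1\<close> contribute at most 2, those of
      \<open>W\<close> at most \<open>4 / 50\<close>.\<close>
    show "real (\<Sum>v\<in>A. card {u \<in> B. (v, u) \<notin> parcs G}) \<le> 3 * (\<alpha> * n) * n"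
    proof -
      have "(\<Sum>v\<in>A. card {u \<in> B. \<not> E v u}) \<le> (\<Sum>v\<in>A. card {u \<in> V2. \<not> E v u})"
        using missB by (rule sum_mono)
      also have "\<dots> = (\<Sum>v\<in>V1. card {u \<in> V2. \<not> E v u}) + (\<Sum>v\<in>W. card {u \<in> V2. \<not> E v u})"
        unfolding A_def using fin finW V(2) WV by (intro sum.union_disjoint) auto
      finally have "real (\<Sum>v\<in>A. card {u \<in> B. \<not> E v u}) \<le> real (\<Sum>v\<in>V1. card {u \<in> V2. \<not> E v u})
          + real (\<Sum>v\<in>W. card {u \<in> V2. \<not> E v u})"
        by (simp only: of_nat_le_iff flip: of_nat_add)
      moreover have "real (\<Sum>v\<in>W. card {u \<in> V2. \<not> E v u}) \<le> (\<Sum>v\<in>W. n / 50)"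
        using missW by (simp only: of_nat_sum) (rule sum_mono)
      moreover have "(\<Sum>v\<in>W. n / 50) \<le> 4 * (\<alpha> * n) * (n / 50)"
        using cW n_pos by (simp add: mult_right_mono)
      moreover have "real (card V1) * (2 * (\<alpha> * n)) \<le> n * (2 * (\<alpha> * n))"
        using nn n(2) by (intro mult_right_mono) auto
      moreover have "0 \<le> \<alpha> * n * n" using \<alpha>(1) n_pos by simp
      ultimately show ?thesis using sum1 unfolding E_def by argo
    qed
  qed
qed

theorem theorem4p3:
  shows "\<exists>\<alpha>\<^sub>0::real. \<alpha>\<^sub>0 > 0 \<and> (\<forall>\<alpha>::real. 0 < \<alpha> \<and> \<alpha> \<le> \<alpha>\<^sub>0 \<longrightarrow>
    (\<exists>\<beta>\<^sub>0::real. \<beta>\<^sub>0 > 0 \<and> (\<forall>\<beta>::real. 0 < \<beta> \<and> \<beta> \<le> \<beta>\<^sub>0 \<longrightarrow>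
      (\<exists>n\<^sub>0::nat. \<forall>n\<ge>n\<^sub>0. \<forall>(G :: 'a pair_pre_digraph) V\<^sub>1 V\<^sub>2.
         pair_graph G \<and> card (pverts G) = n \<and> k_connected 3 G \<and>
         real (min_degree G) \<ge> (2 * real n + 3) / 5 \<and>
         V\<^sub>1 \<union> V\<^sub>2 = pverts G \<and> V\<^sub>1 \<inter> V\<^sub>2 = {} \<and>
         real (card V\<^sub>1) > (3 / 5 - \<alpha>) * real n \<and>
         density G V\<^sub>1 V\<^sub>2 \<ge> 1 - 3 * \<alpha> \<and>
         (\<forall>v\<in>V\<^sub>1. real (degree_into G v V\<^sub>2) \<ge> (2 * real n + 3) / 5 - 2 * \<beta> * real n)
         \<longrightarrow> (\<exists>H. spanning_generalized_Halin H G)))))"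
proof (rule exI[of _ "1 / 10 ^ 8"], intro conjI allI impI)
  \<comment> \<open>The constant is small enough for the accumulated losses, for instance for
    \<open>103 * \<alpha> \<le> 1 / 500000\<close>, which bounds the missing pairs after both
    moves.\<close>
  show "(0::real) < 1 / 10 ^ 8" by simp
  fix \<alpha> :: real assume \<alpha>: "0 < \<alpha> \<and> \<alpha> \<le> 1 / 10 ^ 8"
  show "\<exists>\<beta>\<^sub>0::real. \<beta>\<^sub>0 > 0 \<and> (\<forall>\<beta>::real. 0 < \<beta> \<and> \<beta> \<le> \<beta>\<^sub>0 \<longrightarrow>
      (\<exists>n\<^sub>0::nat. \<forall>n\<ge>n\<^sub>0. \<forall>(G :: 'a pair_pre_digraph) V\<^sub>1 V\<^sub>2.
         pair_graph G \<and> card (pverts G) = n \<and> k_connected 3 G \<and>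
         real (min_degree G) \<ge> (2 * real n + 3) / 5 \<and>
         V\<^sub>1 \<union> V\<^sub>2 = pverts G \<and> V\<^sub>1 \<inter> V\<^sub>2 = {} \<and>
         real (card V\<^sub>1) > (3 / 5 - \<alpha>) * real n \<and>
         density G V\<^sub>1 V\<^sub>2 \<ge> 1 - 3 * \<alpha> \<and>
         (\<forall>v\<in>V\<^sub>1. real (degree_into G v V\<^sub>2) \<ge> (2 * real n + 3) / 5 - 2 * \<beta> * real n)
         \<longrightarrow> (\<exists>H. spanning_generalized_Halin H G)))"
  \<comment> \<open>With this bound on \<open>\<beta>\<close> the error
    \<open>2 * \<beta> * n\<close> is at most \<open>\<alpha> * n\<close>, so a single small
    parameter remains.\<close>
  proof (rule exI[of _ "\<alpha> / 2"], intro conjI allI impI)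
    show "0 < \<alpha> / 2" using \<alpha> by simp
    fix \<beta> :: real assume \<beta>: "0 < \<beta> \<and> \<beta> \<le> \<alpha> / 2"
    \<comment> \<open>The threshold for \<open>n\<close> gives
      \<open>\<alpha> * n \<ge> 100\<close>, so that additive constants are absorbed by multiples of
      \<open>\<alpha> * n\<close>.\<close>
    have "\<exists>H. spanning_generalized_Halin H G"
      if n: "nat \<lceil>100 / \<alpha>\<rceil> \<le> n" and G: "pair_graph G" "card (pverts G) = n"
        and mindeg: "real (min_degree G) \<ge> (2 * real n + 3) / 5"
        and V: "V1 \<union> V2 = pverts G" "V1 \<inter> V2 = {}" "real (card V1) > (3 / 5 - \<alpha>) * real n"
        and deg: "\<forall>v\<in>V1. real (degree_into G v V2) \<ge> (2 * real n + 3) / 5 - 2 * \<beta> * real n"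
      for n and G :: "'a pair_pre_digraph" and V1 V2
    proof (rule Halin_near_extremal[OF G(1) V(1,2)])
      show "real n = real (card (pverts G))" using G(2) by simp
      have "real n \<ge> 100 / \<alpha>" using n by linarith
      then show "\<alpha> * real n \<ge> 100" using \<alpha> by (simp add: field_simps)
      show "0 < \<alpha>" "\<alpha> \<le> 1 / 10 ^ 8" using \<alpha> by auto
      show "(2 * real n + 3) / 5 \<le> real (card {u \<in> pverts G. (v, u) \<in> parcs G})"
        if "v \<in> pverts G" for v
        using mindeg min_degree_le[OF G(1) that] by linarith
      show "(3 / 5 - \<alpha>) * real n < real (card V1)" by (rule V(3))
      show "(2 * real n + 3) / 5 - \<alpha> * real n \<le> real (card {u \<in> V2. (v, u) \<in> parcs G})"
        if "v \<in> V1" for v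
      proof -
        have "2 * \<beta> * real n \<le> \<alpha> * real n" using \<beta> by (intro mult_right_mono) auto
        moreover have "(2 * real n + 3) / 5 - 2 * \<beta> * real n \<le> real (degree_into G v V2)"
          using deg that by blast
        ultimately show ?thesis unfolding degree_into_def by linarith
      qed
    qed
    then show "\<exists>n\<^sub>0::nat. \<forall>n\<ge>n\<^sub>0. \<forall>(G :: 'a pair_pre_digraph) V\<^sub>1 V\<^sub>2.
         pair_graph G \<and> card (pverts G) = n \<and> k_connected 3 G \<and>
         real (min_degree G) \<ge> (2 * real n + 3) / 5 \<and>
         V\<^sub>1 \<union> V\<^sub>2 = pverts G \<and> V\<^sub>1 \<inter> V\<^sub>2 = {} \<and>
         real (card V\<^sub>1) > (3 / 5 - \<alpha>) * real n \<and>
         density G V\<^sub>1 V\<^sub>2 \<ge> 1 - 3 * \<alpha> \<and>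
         (\<forall>v\<in>V\<^sub>1. real (degree_into G v V\<^sub>2) \<ge> (2 * real n + 3) / 5 - 2 * \<beta> * real n)
         \<longrightarrow> (\<exists>H. spanning_generalized_Halin H G)"
      by blast
  qed
qed

end
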